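(* For any smooth projective curve $C$ and any $d\ge 2$, the symmetric power $C_d$ of $C$ is super-Liouville; that is, any (connected) non-ramified covering over $C_d$ is Liouville.
   Context: All varieties are over $\mathbb{C}$. $C_d$ is the $d$-th symmetric power of $C$, i.e. the quotient of $C^d$ by the symmetric group $S_d$. A complex space is called Liouville if it carries no non-constant bounded holomorphic functions, and super-Liouville if its universal cover is Liouville. *)

theory Defs
  imports "HOL-Analysis.Analysis"
begin

section \<open>Projective varieties\<close>

text \<open>Points of \<open>P\<^sup>n\<close>, \<open>n + 1 = CARD('n)\<close>, are the one-dimensional subspaces of \<^typ>\<open>complex ^ 'n\<close>.\<close>

definition proj_point :: "complex ^ 'n \<Rightarrow> (complex ^ 'n) set"
  where "proj_point x = vec.span {x}"

definition proj_space :: "(complex ^ 'n) set set"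
  where "proj_space = proj_point ` (- {0})"

definition homogeneous_poly :: "nat \<Rightarrow> (complex ^ 'n \<Rightarrow> complex) \<Rightarrow> bool"
  where "homogeneous_poly k f \<longleftrightarrow>
    (\<exists>c :: ('n \<Rightarrow> nat) \<Rightarrow> complex.
      f = (\<lambda>x. \<Sum>a | sum a UNIV = k. c a * (\<Prod>i\<in>UNIV. x $ i ^ a i)))"

definition proj_zeros :: "(complex ^ 'n \<Rightarrow> complex) set \<Rightarrow> (complex ^ 'n) set set"
  where "proj_zeros F = {L \<in> proj_space. \<forall>f\<in>F. \<forall>x\<in>L. f x = 0}"

definition proj_closed :: "(complex ^ 'n) set set \<Rightarrow> bool"
  where "proj_closed X \<longleftrightarrow> (\<exists>F. (\<forall>f\<in>F. \<exists>k. homogeneous_poly k f) \<and> X = proj_zeros F)"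

definition proj_irreducible :: "(complex ^ 'n) set set \<Rightarrow> bool"
  where "proj_irreducible X \<longleftrightarrow> proj_closed X \<and> X \<noteq> {} \<and>
    (\<forall>A B. proj_closed A \<and> proj_closed B \<and> X \<subseteq> A \<union> B \<longrightarrow> X \<subseteq> A \<or> X \<subseteq> B)"

text \<open>Krull dimension of the Zariski topology.\<close>

definition proj_dim :: "(complex ^ 'n) set set \<Rightarrow> enat"
  where "proj_dim X = Sup {enat k | k. \<exists>Z. (\<forall>i\<le>k. proj_irreducible (Z i) \<and> Z i \<subseteq> X) \<and>
    (\<forall>i<k. Z i \<subset> Z (Suc i))}"

text \<open>The Zariski tangent space at \<open>x \<noteq> 0\<close> of the affine cone over \<open>X\<close>: the common kernel of
  the differentials at \<open>x\<close> of the elements of the homogeneous ideal of \<open>X\<close>. Its quotient by the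
  line through \<open>x\<close> is isomorphic to the Zariski tangent space of \<open>X\<close> at \<open>proj_point x\<close>, whence
  the \<open>+ 1\<close> in the definition of smoothness.\<close>

definition cone_tangent :: "(complex ^ 'n) set set \<Rightarrow> complex ^ 'n \<Rightarrow> (complex ^ 'n) set"
  where "cone_tangent X x =
    {v. \<forall>k f. homogeneous_poly k f \<and> (\<forall>L\<in>X. \<forall>y\<in>L. f y = 0) \<longrightarrow>
      deriv (\<lambda>t. f (x + t *s v)) 0 = 0}"

definition proj_smooth :: "(complex ^ 'n) set set \<Rightarrow> bool"
  where "proj_smooth X \<longleftrightarrow>
    (\<forall>x. x \<noteq> 0 \<and> proj_point x \<in> X \<longrightarrow> enat (vec.dim (cone_tangent X x)) = proj_dim X + 1)"

definition smooth_projective_curve :: "(complex ^ 'n) set set \<Rightarrow> bool"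
  where "smooth_projective_curve X \<longleftrightarrow> proj_irreducible X \<and> proj_dim X = 1 \<and> proj_smooth X"


section \<open>Spaces with a sheaf of holomorphic functions\<close>

text \<open>A reduced complex space is given by its topology and its sheaf of holomorphic functions:
  \<open>hol X U f\<close> means that \<open>f\<close> is holomorphic on the open set \<open>U\<close>. It is only used for open \<open>U\<close>,
  and the values of \<open>f\<close> outside \<open>U\<close> play no role.\<close>

record 'a holspace =
  topol :: "'a topology"
  hol :: "'a set \<Rightarrow> ('a \<Rightarrow> complex) \<Rightarrow> bool"

text \<open>Sections over \<open>W\<close> of the inverse image of the structure sheaf of \<open>X\<close> under a continuous map
  \<open>p\<close> from \<open>T\<close> to \<open>X\<close>, seen as functions: those that locally are of the form \<open>g \<circ> p\<close> with \<open>g\<close>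
  holomorphic.\<close>

definition pullback_hol ::
    "'a topology \<Rightarrow> ('a \<Rightarrow> 'b) \<Rightarrow> 'b holspace \<Rightarrow> 'a set \<Rightarrow> ('a \<Rightarrow> complex) \<Rightarrow> bool"
  where "pullback_hol T p X W f \<longleftrightarrow>
    (\<forall>e\<in>W. \<exists>V U g. openin T V \<and> e \<in> V \<and> V \<subseteq> W \<and>
      openin (topol X) U \<and> p ` V \<subseteq> U \<and> hol X U g \<and> (\<forall>y\<in>V. f y = g (p y)))"

text \<open>For an analytic subset \<open>S\<close> of \<open>X\<close> this is its reduced structure: holomorphic functions are
  locally restrictions of holomorphic functions of the ambient space.\<close>

definition hol_subspace :: "'a holspace \<Rightarrow> 'a set \<Rightarrow> 'a holspace"
  where "hol_subspace X S =
    \<lparr>topol = subtopology (topol X) S, hol = pullback_hol (subtopology (topol X) S) (\<lambda>x. x) X\<rparr>"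

definition quotient_topology :: "'a topology \<Rightarrow> ('a \<Rightarrow> 'b) \<Rightarrow> 'b topology"
  where "quotient_topology T q =
    topology (\<lambda>U. U \<subseteq> q ` topspace T \<and> openin T {x \<in> topspace T. q x \<in> U})"

lemma openin_quotient_topology:
  "openin (quotient_topology T q) U \<longleftrightarrow> U \<subseteq> q ` topspace T \<and> openin T {x \<in> topspace T. q x \<in> U}"
proof -
  have "istopology (\<lambda>U. U \<subseteq> q ` topspace T \<and> openin T {x \<in> topspace T. q x \<in> U})"
    unfolding istopology_def
  proof (intro conjI allI impI)
    fix A B
    assume A: "A \<subseteq> q ` topspace T \<and> openin T {x \<in> topspace T. q x \<in> A}"
      and B: "B \<subseteq> q ` topspace T \<and> openin T {x \<in> topspace T. q x \<in> B}"
    from A show "A \<inter> B \<subseteq> q ` topspace T" by blast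
    have eq: "{x \<in> topspace T. q x \<in> A \<inter> B} =
        {x \<in> topspace T. q x \<in> A} \<inter> {x \<in> topspace T. q x \<in> B}" by blast
    show "openin T {x \<in> topspace T. q x \<in> A \<inter> B}"
      unfolding eq by (rule openin_Int) (use A B in blast)+
  next
    fix K
    assume K: "\<forall>A\<in>K. A \<subseteq> q ` topspace T \<and> openin T {x \<in> topspace T. q x \<in> A}"
    then show "\<Union>K \<subseteq> q ` topspace T" by blast
    have eq: "{x \<in> topspace T. q x \<in> \<Union>K} = \<Union>((\<lambda>A. {x \<in> topspace T. q x \<in> A}) ` K)" by blast
    show "openin T {x \<in> topspace T. q x \<in> \<Union>K}"
      unfolding eq by (rule openin_Union) (use K in blast)
  qed
  then show ?thesis unfolding quotient_topology_def by (simp only: topology_inverse')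
qed

lemma quotient_map_quotient_topology: "quotient_map T (quotient_topology T q) q"
proof -
  have eq: "{x \<in> topspace T. q x \<in> q ` topspace T} = topspace T" by blast
  have top: "topspace (quotient_topology T q) = q ` topspace T"
  proof (rule antisym)
    show "topspace (quotient_topology T q) \<subseteq> q ` topspace T"
      using openin_topspace[of "quotient_topology T q"] unfolding openin_quotient_topology
      by (rule conjunct1)
    have "openin (quotient_topology T q) (q ` topspace T)"
      unfolding openin_quotient_topology eq by (intro conjI subset_refl openin_topspace)
    then show "q ` topspace T \<subseteq> topspace (quotient_topology T q)" by (rule openin_subset)
  qed
  show ?thesis
    unfolding quotient_map_def top openin_quotient_topology by blast
qed

text \<open>For the orbit map of a finite group of automorphisms this is the quotient complex space:
  holomorphic functions are those whose pullback, an invariant function, is holomorphic.\<close>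

definition hol_quotient :: "'a holspace \<Rightarrow> ('a \<Rightarrow> 'b) \<Rightarrow> 'b holspace"
  where "hol_quotient X q =
    \<lparr>topol = quotient_topology (topol X) q,
     hol = (\<lambda>U f. hol X {x \<in> topspace (topol X). q x \<in> U} (f \<circ> q))\<rparr>"


section \<open>Symmetric powers of a projective variety\<close>

text \<open>Holomorphic functions of the \<open>d (n + 1)\<close> variables \<open>x $ i $ j\<close>, for \<open>d = CARD('d)\<close>:
  real differentiable with complex linear differential.\<close>

definition holomorphic_vars :: "(complex ^ 'n ^ 'd \<Rightarrow> complex) \<Rightarrow> (complex ^ 'n ^ 'd) set \<Rightarrow> bool"
  where "holomorphic_vars f U \<longleftrightarrow>
    (\<forall>x\<in>U. \<exists>D. (f has_derivative D) (at x) \<and> (\<forall>c v. D (\<chi> i. c *s v $ i) = c * D v))"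

definition proj_topology :: "(complex ^ 'n) set topology"
  where "proj_topology = quotient_topology (top_of_set (- {0})) proj_point"

text \<open>The complex manifold \<open>(P\<^sup>n)\<^sup>d\<close>; a function on it is holomorphic iff it is so as a function of
  the homogeneous coordinates.\<close>

definition multiproj_space :: "('d::finite \<Rightarrow> (complex ^ 'n) set) holspace"
  where "multiproj_space =
    \<lparr>topol = product_topology (\<lambda>_. proj_topology) UNIV,
     hol = (\<lambda>U f. holomorphic_vars (\<lambda>x. f (\<lambda>i. proj_point (x $ i)))
       {x. (\<forall>i. x $ i \<noteq> 0) \<and> (\<lambda>i. proj_point (x $ i)) \<in> U})\<rparr>"

definition cartesian_power :: "(complex ^ 'n) set set \<Rightarrow> ('d::finite \<Rightarrow> (complex ^ 'n) set) holspace"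
  where "cartesian_power C = hol_subspace multiproj_space {y. \<forall>i. y i \<in> C}"

definition sym_orbit :: "('d \<Rightarrow> 'a) \<Rightarrow> ('d \<Rightarrow> 'a) set"
  where "sym_orbit y = {y \<circ> s | s. s permutes UNIV}"

definition sym_power :: "(complex ^ 'n) set set \<Rightarrow> ('d::finite \<Rightarrow> (complex ^ 'n) set) set holspace"
  where "sym_power C = hol_quotient (cartesian_power C) sym_orbit"


section \<open>Coverings and the Liouville property\<close>

definition liouville :: "'a holspace \<Rightarrow> bool"
  where "liouville X \<longleftrightarrow>
    (\<forall>f. hol X (topspace (topol X)) f \<and> bounded (f ` topspace (topol X)) \<longrightarrow>
      f constant_on topspace (topol X))"

text \<open>The counterparts of \<^const>\<open>covering_space\<close> and \<^const>\<open>simply_connected\<close> for abstract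
  topologies.\<close>

definition covering_map :: "'e topology \<Rightarrow> ('e \<Rightarrow> 'a) \<Rightarrow> 'a topology \<Rightarrow> bool"
  where "covering_map T p X \<longleftrightarrow> continuous_map T X p \<and> p ` topspace T = topspace X \<and>
    (\<forall>x\<in>topspace X. \<exists>U. x \<in> U \<and> openin X U \<and>
      (\<exists>\<V>. \<Union>\<V> = {e \<in> topspace T. p e \<in> U} \<and> (\<forall>V\<in>\<V>. openin T V) \<and> pairwise disjnt \<V> \<and>
        (\<forall>V\<in>\<V>. homeomorphic_map (subtopology T V) (subtopology X U) p)))"

definition simply_connected_space :: "'a topology \<Rightarrow> bool"
  where "simply_connected_space T \<longleftrightarrow>
    (\<forall>p q. pathin T p \<and> p 1 = p 0 \<and> pathin T q \<and> q 1 = q 0 \<longrightarrow>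
      homotopic_with (\<lambda>h. h 1 = h 0) (top_of_set {0..1}) T p q)"

text \<open>Coverings are topological, of arbitrary (possibly infinite) degree; the total space carries
  the unique complex structure making \<open>p\<close> locally biholomorphic, that is, its structure sheaf is the
  inverse image of that of \<open>X\<close>.\<close>

definition unramified_covering :: "'e holspace \<Rightarrow> ('e \<Rightarrow> 'a) \<Rightarrow> 'a holspace \<Rightarrow> bool"
  where "unramified_covering E p X \<longleftrightarrow> covering_map (topol E) p (topol X) \<and>
    (\<forall>W f. openin (topol E) W \<longrightarrow> (hol E W f \<longleftrightarrow> pullback_hol (topol E) p X W f))"

definition universal_covering :: "'e holspace \<Rightarrow> ('e \<Rightarrow> 'a) \<Rightarrow> 'a holspace \<Rightarrow> bool"
  where "universal_covering E p X \<longleftrightarrow>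
    unramified_covering E p X \<and> simply_connected_space (topol E)"

text \<open>The type argument is the type carrying the points of the universal covering, which is unique
  only up to isomorphism; it is to be read as universally quantified.\<close>

definition super_liouville :: "'e itself \<Rightarrow> 'a holspace \<Rightarrow> bool"
  where "super_liouville _ X \<longleftrightarrow>
    (\<forall>(E :: 'e holspace) p. universal_covering E p X \<longrightarrow> liouville E)"

end

theory Submission
  imports Defs "HOL-Complex_Analysis.Conformal_Mappings"
begin

text \<open>
  For \<open>d \<ge> 2\<close> the fundamental group of \<open>C\<^sub>d\<close> is abelian: it is generated by the loops in which one
  of the \<open>d\<close> points runs through a loop of \<open>C\<close>, loops of two different points commute, and at a
  divisor in which the two points coincide it does not matter which of them moves. The proof plays
  this observation off against Harnack's inequality, without fundamental groups and universal
  coverings. Loops are replaced by chains of steps, each of them inside a small disc of \<open>C\<close>, and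
  finitely many such discs, fixed once and for all, are so small that the image of every product of
  \<open>d\<close> of them lies in an evenly covered set.

  Let \<open>f\<close> be holomorphic and bounded on a connected covering \<open>E\<close> of \<open>C\<^sub>d\<close>. It is enough that \<open>f\<close> does
  not change while one of the \<open>d\<close> points moves, since then \<open>f\<close> is locally constant. Fix all but two
  points and consider \<open>E\<close> over \<open>x + y + D\<close>. A closed chain \<open>\<beta>\<close> of steps of the second point at \<open>y\<close>
  defines a transformation \<open>T\<close> of the part of \<open>E\<close> where only \<open>x\<close> varies, and \<open>T\<close> commutes with all
  motions of \<open>x\<close>, because products of two discs lift to \<open>E\<close>. So \<open>h = f \<circ> T - f\<close> is again
  holomorphic. Let \<open>M\<close> be the supremum of the real part of \<open>a * h\<close> for a constant \<open>a\<close>. As \<open>C\<close> is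
  compact, Harnack's inequality shows that \<open>M\<close> is nearly attained at a point \<open>e\<close> over \<open>x = y\<close>. There
  \<open>T\<close> is the motion of the \<open>first\<close> point along \<open>\<beta>\<close>, so by Harnack's inequality \<open>M\<close> is still nearly
  attained at \<open>T e\<close>, \<open>T (T e)\<close>, and so on. Summing up, \<open>a * f\<close> grows by almost \<open>K * M\<close> along \<open>K\<close>
  iterations, and \<open>M > 0\<close> contradicts the boundedness of \<open>f\<close>. Hence \<open>f \<circ> T = f\<close>
  (\<open>loop_invariant\<close>), so \<open>f\<close> is constant on the points over \<open>x = y\<close> that are reached from
  one of them by moving \<open>x\<close>, and the maximum principle gives constancy for all \<open>x\<close>
  (\<open>transport_invariant\<close>).

  The discs come from the inverse function theorem (\<open>chart_exists\<close>). Smoothness provides, near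
  any point of the cone over \<open>C\<close>, a holomorphic disc that contains all nearby points of \<open>C\<close>. That the
  disc is contained in \<open>C\<close> follows without any dimension theory from the fact that no point of \<open>C\<close> is
  isolated: polynomials of the ideal of \<open>C\<close> have zeros on the disc that accumulate at its centre.
  There are no isolated points because \<open>C\<close> is connected in the classical topology, and this in turn
  is inherited from \<open>E\<close> (\<open>connected_curve\<close>).
\<close>

section \<open>Harnack's inequality on the unit disc\<close>

text \<open>The best constant is \<open>(1 + r) / (1 - r)\<close>. This one is at most twice as large and is what
  the Schwarz lemma gives without solving a quadratic equation.\<close>

definition harnack_const :: "real \<Rightarrow> real"
  where "harnack_const r = 2 * (1 + r\<^sup>2) / (1 - r\<^sup>2)"

lemma harnack_const_ge_1:
  assumes "0 \<le> r" "r < 1"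
  shows "harnack_const r \<ge> 1"
proof -
  have "r\<^sup>2 < 1" using assms by (simp add: power_less_one_iff abs_square_less_1)
  then show ?thesis unfolding harnack_const_def by (simp add: field_simps)
qed

lemma harnack_const_le_4:
  assumes "0 \<le> r" "r \<le> 1/2"
  shows "harnack_const r \<le> 4"
proof -
  have "r\<^sup>2 \<le> (1/2)\<^sup>2" using assms by (intro power_mono) auto
  then have "r\<^sup>2 \<le> 1/4" by (simp add: power2_eq_square)
  then show ?thesis unfolding harnack_const_def by (simp add: field_simps)
qed

text \<open>The Cayley transform \<open>w \<mapsto> (w - g 0) / (w + cnj (g 0))\<close> takes the right half plane to the unit
  disc and \<open>g 0\<close> to \<open>0\<close>, so the Schwarz lemma applies to its composition with \<open>g\<close>.\<close>

lemma harnack_centre: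
  assumes hol: "g holomorphic_on ball 0 1"
    and pos: "\<And>z. norm z < 1 \<Longrightarrow> Re (g z) > 0"
    and z: "norm z < 1"
  shows "Re (g z) \<le> harnack_const (norm z) * Re (g 0)"
    and "Re (g 0) \<le> harnack_const (norm z) * Re (g z)"
proof -
  define r where "r = norm z"
  define a where "a = Re (g 0)"
  have a: "a > 0" using pos[of 0] by (simp add: a_def)
  have r: "0 \<le> r" "r < 1" using z by (auto simp: r_def)
  then have r2: "r\<^sup>2 < 1" by (simp add: abs_square_less_1)
  have less: "norm (w - g 0) < norm (w + cnj (g 0))" if "Re w > 0" for w
  proof -
    have "(norm (w + cnj (g 0)))\<^sup>2 - (norm (w - g 0))\<^sup>2 = 4 * Re w * a"
      unfolding cmod_power2 by (simp add: a_def power2_eq_square algebra_simps)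
    also have "\<dots> > 0" using that a by simp
    finally show ?thesis by (simp add: power2_less_imp_less)
  qed
  define F where "F w = (g w - g 0) / (g w + cnj (g 0))" for w
  have nz: "g w + cnj (g 0) \<noteq> 0" if "norm w < 1" for w
    using less[OF pos[OF that]] by fastforce
  have "F holomorphic_on ball 0 1"
    unfolding F_def by (intro holomorphic_intros hol) (use nz in auto)
  moreover have "norm (F w) < 1" if "norm w < 1" for w
    using less[OF pos[OF that]] nz[OF that] by (simp add: F_def norm_divide divide_simps)
  ultimately have "norm (F z) \<le> norm z"
    using Schwarz_Lemma(1)[of F z] z by (simp add: F_def)
  then have "norm (g z - g 0) \<le> r * norm (g z + cnj (g 0))"
    using nz[OF z] by (simp add: F_def norm_divide divide_simps r_def)
  then have "(norm (g z - g 0))\<^sup>2 \<le> (r * norm (g z + cnj (g 0)))\<^sup>2"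
    by (intro power_mono) auto
  then have *: "(Re (g z) - a)\<^sup>2 + (Im (g z) - Im (g 0))\<^sup>2 \<le>
      r\<^sup>2 * ((Re (g z) + a)\<^sup>2 + (Im (g z) - Im (g 0))\<^sup>2)"
    by (simp add: power_mult_distrib cmod_power2 a_def)
  define s where "s = Re (g z)"
  have s: "s > 0" using pos[OF z] by (simp add: s_def)
  have "r\<^sup>2 * (Im (g z) - Im (g 0))\<^sup>2 \<le> (Im (g z) - Im (g 0))\<^sup>2"
    using r2 by (intro mult_left_le_one_le) auto
  with * have "(s - a)\<^sup>2 \<le> r\<^sup>2 * (s + a)\<^sup>2"
    by (simp add: s_def distrib_left)
  then have **: "(1 - r\<^sup>2) * s\<^sup>2 + (1 - r\<^sup>2) * a\<^sup>2 \<le> 2 * (1 + r\<^sup>2) * (a * s)"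
    by (simp add: power2_eq_square algebra_simps)
  have "(1 - r\<^sup>2) * a\<^sup>2 \<ge> 0" "(1 - r\<^sup>2) * s\<^sup>2 \<ge> 0" using r2 by auto
  with ** have 1: "s * ((1 - r\<^sup>2) * s) \<le> s * (2 * (1 + r\<^sup>2) * a)"
    and 2: "a * ((1 - r\<^sup>2) * a) \<le> a * (2 * (1 + r\<^sup>2) * s)"
    by (simp_all add: power2_eq_square algebra_simps)
  from 1 s have "(1 - r\<^sup>2) * s \<le> 2 * (1 + r\<^sup>2) * a" by simp
  then show "Re (g z) \<le> harnack_const (norm z) * Re (g 0)"
    using r2 by (simp add: harnack_const_def field_simps flip: r_def s_def a_def)
  from 2 a have "(1 - r\<^sup>2) * a \<le> 2 * (1 + r\<^sup>2) * s" by simp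
  then show "Re (g 0) \<le> harnack_const (norm z) * Re (g z)"
    using r2 by (simp add: harnack_const_def field_simps flip: r_def s_def a_def)
qed

lemma harnack:
  assumes hol: "g holomorphic_on ball 0 1"
    and pos: "\<And>z. norm z < 1 \<Longrightarrow> Re (g z) > 0"
    and z: "norm z < 1" and z': "norm z' < 1"
  shows "Re (g z') \<le> harnack_const (norm z) * harnack_const (norm z') * Re (g z)"
proof -
  have "Re (g z') \<le> harnack_const (norm z') * Re (g 0)"
    using harnack_centre(1)[OF hol pos z'] by simp
  also have "\<dots> \<le> harnack_const (norm z') * (harnack_const (norm z) * Re (g z))"
    using harnack_centre(2)[OF hol pos z] harnack_const_ge_1[of "norm z'"] z'
    by (intro mult_left_mono) auto
  finally show ?thesis by (simp add: mult_ac)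
qed

section \<open>Moving two points\<close>

text \<open>Here \<open>Fib x y\<close> stands for the fibre of a covering of \<open>C\<^sub>d\<close> over \<open>x + y + D\<close>, with \<open>D\<close> of
  degree \<open>d - 2\<close> fixed, the map \<open>pt i\<close> parametrises the \<open>i\<close>-th disc, and \<open>t i z z' y\<close> moves the first
  of the two points from \<open>pt i z\<close> to \<open>pt i z'\<close> while \<open>y\<close> stays. The same \<open>t\<close> also moves the second
  point, since \<open>Fib\<close> is symmetric; this is how \<open>t_comm\<close> is to be read, and over \<open>x = y\<close> the two
  motions are literally equal. Compactness of \<open>C\<close> is expressed by \<open>fin\<close> and \<open>cover\<close>, where the
  radius \<open>1/2\<close> keeps the Harnack constants bounded, and connectedness by \<open>chain\<close>.\<close>

locale two_slot_transport =
  fixes I :: "'i set" and pt :: "'i \<Rightarrow> complex \<Rightarrow> 'a" and C :: "'a set"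
    and Fib :: "'a \<Rightarrow> 'a \<Rightarrow> 'e set" and t :: "'i \<Rightarrow> complex \<Rightarrow> complex \<Rightarrow> 'a \<Rightarrow> 'e \<Rightarrow> 'e"
    and f :: "'e \<Rightarrow> complex" and B :: real
  assumes fin: "finite I"
    and pt_in: "\<And>i z. i \<in> I \<Longrightarrow> norm z < 1 \<Longrightarrow> pt i z \<in> C"
    and cover: "\<And>x. x \<in> C \<Longrightarrow> \<exists>i\<in>I. \<exists>z. norm z < 1/2 \<and> pt i z = x"
    and chain: "\<And>P x y. \<lbrakk>P x; x \<in> C; y \<in> C;
        \<And>i z z'. \<lbrakk>i \<in> I; norm z < 1; norm z' < 1; P (pt i z)\<rbrakk> \<Longrightarrow> P (pt i z')\<rbrakk> \<Longrightarrow> P y"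
    and Fib_sym: "\<And>x y. Fib x y = Fib y x"
    and t_in: "\<And>i z z' y e. \<lbrakk>i \<in> I; norm z < 1; norm z' < 1; y \<in> C; e \<in> Fib (pt i z) y\<rbrakk>
        \<Longrightarrow> t i z z' y e \<in> Fib (pt i z') y"
    and t_id: "\<And>i z y e. \<lbrakk>i \<in> I; norm z < 1; y \<in> C; e \<in> Fib (pt i z) y\<rbrakk> \<Longrightarrow> t i z z y e = e"
    and t_back: "\<And>i z z' y e. \<lbrakk>i \<in> I; norm z < 1; norm z' < 1; y \<in> C; e \<in> Fib (pt i z) y\<rbrakk>
        \<Longrightarrow> t i z' z y (t i z z' y e) = e"
    and t_comm: "\<And>i z z' j u u' e. \<lbrakk>i \<in> I; norm z < 1; norm z' < 1; j \<in> I; norm u < 1; norm u' < 1;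
        e \<in> Fib (pt i z) (pt j u)\<rbrakk>
        \<Longrightarrow> t j u u' (pt i z') (t i z z' (pt j u) e) = t i z z' (pt j u') (t j u u' (pt i z) e)"
    and t_hol: "\<And>i z y e. \<lbrakk>i \<in> I; norm z < 1; y \<in> C; e \<in> Fib (pt i z) y\<rbrakk>
        \<Longrightarrow> (\<lambda>z'. f (t i z z' y e)) holomorphic_on ball 0 1"
    and f_bound: "\<And>x y e. e \<in> Fib x y \<Longrightarrow> norm (f e) \<le> B"
begin

fun walk :: "'a \<Rightarrow> ('i \<times> complex \<times> complex) list \<Rightarrow> 'a \<Rightarrow> bool" where
  "walk x [] x' \<longleftrightarrow> x = x'"
| "walk x ((i, z, z') # w) x' \<longleftrightarrow> i \<in> I \<and> norm z < 1 \<and> norm z' < 1 \<and> x = pt i z \<and> walk (pt i z') w x'"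

fun transport :: "('i \<times> complex \<times> complex) list \<Rightarrow> 'a \<Rightarrow> 'e \<Rightarrow> 'e" where
  "transport [] y e = e"
| "transport ((i, z, z') # w) y e = transport w y (t i z z' y e)"

text \<open>The factor lost when Harnack's inequality is applied in every step of a walk.\<close>

fun walk_const :: "('i \<times> complex \<times> complex) list \<Rightarrow> real" where
  "walk_const [] = 1"
| "walk_const ((i, z, z') # w) = harnack_const (norm z) * harnack_const (norm z') * walk_const w"

lemma walk_append: "walk x (v @ w) x' \<longleftrightarrow> (\<exists>y. walk x v y \<and> walk y w x')"
  by (induction x v x' rule: walk.induct) auto

lemma transport_append: "transport (v @ w) y e = transport w y (transport v y e)"
  by (induction v y e rule: transport.induct) auto

lemma walk_in: "walk x w x' \<Longrightarrow> x \<in> C \<Longrightarrow> x' \<in> C"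
  by (induction x w x' rule: walk.induct) (auto simp: pt_in)

lemma walk_const_ge_1: "walk x w x' \<Longrightarrow> walk_const w \<ge> 1"
proof (induction x w x' rule: walk.induct)
  case (2 x i z z' w x')
  have "1 * 1 * 1 \<le> harnack_const (norm z) * harnack_const (norm z') * walk_const w"
    using 2 harnack_const_ge_1[of "norm z"] harnack_const_ge_1[of "norm z'"]
    by (intro mult_mono) auto
  then show ?case by simp
qed auto

lemma transport_in:
  "walk x w x' \<Longrightarrow> y \<in> C \<Longrightarrow> e \<in> Fib x y \<Longrightarrow> transport w y e \<in> Fib x' y"
  by (induction x w x' arbitrary: e rule: walk.induct) (auto simp: t_in)

lemma walk_exists:
  assumes "x \<in> C" "y \<in> C"
  shows "\<exists>w. walk x w y"
proof (rule chain[where P = "\<lambda>y. \<exists>w. walk x w y", OF _ assms])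
  show "\<exists>w. walk x w x" by (intro exI[of _ "[]"]) simp
next
  fix i and z z' :: complex
  assume i: "i \<in> I" "norm z < 1" "norm z' < 1" and "\<exists>w. walk x w (pt i z)"
  then obtain w where "walk x w (pt i z)" by blast
  then have "walk x (w @ [(i, z, z')]) (pt i z')" using i by (auto simp: walk_append)
  then show "\<exists>w. walk x w (pt i z')" by blast
qed

text \<open>Finitely many walks are enough, one from the centre of each disc; a point of \<open>C\<close> lies in some half
  disc and is first moved to the centre.\<close>

lemma walk_uniform:
  assumes "y \<in> C"
  obtains c where "c > 0" "\<And>x. x \<in> C \<Longrightarrow> \<exists>w. walk x w y \<and> walk_const w \<le> c"
proof -
  have "\<forall>i\<in>I. \<exists>w. walk (pt i 0) w y" using walk_exists assms pt_in by simp
  then obtain w where w: "\<And>i. i \<in> I \<Longrightarrow> walk (pt i 0) (w i) y" by metis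
  define c where "c = 1 + (\<Sum>i\<in>I. 16 * walk_const (w i))"
  have w1: "walk_const (w i) \<ge> 1" if "i \<in> I" for i using walk_const_ge_1 w that by blast
  have "c > 0"
    unfolding c_def by (intro add_pos_nonneg sum_nonneg) (use w1 in force)+
  moreover have "\<exists>w. walk x w y \<and> walk_const w \<le> c" if x: "x \<in> C" for x
  proof -
    obtain i z where i: "i \<in> I" "norm z < 1/2" "x = pt i z" using cover[OF x] by blast
    have "harnack_const (norm z) * harnack_const (norm (0::complex)) * walk_const (w i)
        \<le> 4 * 4 * walk_const (w i)"
      using i w1[OF i(1)] harnack_const_ge_1[of 0] harnack_const_ge_1[of "norm z"]
      by (intro mult_mono harnack_const_le_4) auto
    also have "\<dots> \<le> c"
    proof -
      have "16 * walk_const (w i) \<le> (\<Sum>i\<in>I. 16 * walk_const (w i))"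
        by (rule member_le_sum) (use i fin w1 in force)+
      then show ?thesis by (simp add: c_def)
    qed
    finally show ?thesis
      using i w by (intro exI[of _ "(i, z, 0) # w i"]) auto
  qed
  ultimately show ?thesis using that by blast
qed

lemma walk_back:
  assumes "walk x w x'" "y \<in> C"
  shows "\<exists>v. walk x' v x \<and> (\<forall>e \<in> Fib x y. transport v y (transport w y e) = e)"
  using assms
proof (induction x w x' rule: walk.induct)
  case (1 x x')
  then show ?case by (intro exI[of _ "[]"]) auto
next
  case (2 x i z z' w x')
  then obtain v where "walk x' v (pt i z')"
    "\<And>e. e \<in> Fib (pt i z') y \<Longrightarrow> transport v y (transport w y e) = e" by auto
  then show ?case
    using 2 by (intro exI[of _ "v @ [(i, z', z)]"])
      (auto simp: walk_append transport_append t_in t_back)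
qed

text \<open>All that remains of the commutativity of the fundamental group: a walk of the first point commutes
  with a step of the second one.\<close>

lemma transport_comm:
  assumes "walk x w x'" "i \<in> I" "norm z < 1" "norm z' < 1" "e \<in> Fib x (pt i z)" "x \<in> C"
  shows "t i z z' x' (transport w (pt i z) e) = transport w (pt i z') (t i z z' x e)"
  using assms
proof (induction x w x' arbitrary: e rule: walk.induct)
  case (2 x j u u' w x')
  then have "t i z z' (pt j u') (t j u u' (pt i z) e) = t j u u' (pt i z') (t i z z' (pt j u) e)"
    by (intro t_comm) auto
  with 2 show ?case by (simp add: t_in pt_in)
qed auto

text \<open>The function \<open>q\<close> may depend on the base point \<open>x\<close> because the transformation \<open>T\<close> does, by which it
  will be defined. The family \<open>S\<close> will be the whole of \<open>Fib\<close> in one application and in the other one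
  the set of points that can be reached from a given one.\<close>

lemma harnack_walk:
  assumes y: "y \<in> C"
    and S_sub: "\<And>x. S x \<subseteq> Fib x y"
    and S_closed: "\<And>i z z' e. \<lbrakk>i \<in> I; norm z < 1; norm z' < 1; e \<in> S (pt i z)\<rbrakk>
        \<Longrightarrow> t i z z' y e \<in> S (pt i z')"
    and q_hol: "\<And>i z e. \<lbrakk>i \<in> I; norm z < 1; e \<in> S (pt i z)\<rbrakk>
        \<Longrightarrow> (\<lambda>z'. q (pt i z') (t i z z' y e)) holomorphic_on ball 0 1"
    and q_pos: "\<And>x e. x \<in> C \<Longrightarrow> e \<in> S x \<Longrightarrow> Re (q x e) > 0"
    and "walk x w x'" "x \<in> C" "e \<in> S x"
  shows "Re (q x' (transport w y e)) \<le> walk_const w * Re (q x e)"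
  using assms(6-)
proof (induction x w x' arbitrary: e rule: walk.induct)
  case (2 x i z z' w x')
  let ?g = "\<lambda>u. q (pt i u) (t i z u y e)"
  have i: "i \<in> I" "norm z < 1" "norm z' < 1" "x = pt i z" "walk (pt i z') w x'" using 2 by auto
  have e: "e \<in> S (pt i z)" "t i z z y e \<in> S (pt i z)" using 2 S_closed by auto
  have *: "t i z z y e = e"
  proof -
    have e': "e \<in> Fib (pt i z) y" "t i z z y e \<in> Fib (pt i z) y" using e S_sub by auto
    show ?thesis using t_id i e' y by simp
  qed
  have "Re (q x' (transport w y (t i z z' y e))) \<le> walk_const w * Re (?g z')"
    using 2(1)[OF i(5), of "t i z z' y e"] i e S_closed pt_in by simp
  also have "\<dots> \<le> walk_const w * (harnack_const (norm z) * harnack_const (norm z') * Re (?g z))"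
    using walk_const_ge_1[OF i(5)] i e q_hol q_pos S_closed pt_in
    by (intro mult_left_mono harnack) auto
  finally show ?case using i * by (simp add: mult_ac)
qed auto


text \<open>Suppose that the supremum \<open>M\<close> of the values in question is positive. By the uniform Harnack
  inequality a point \<open>E 0\<close> over \<open>x = y\<close> nearly realises it. Since \<open>transport \<beta>\<close> is there also a walk
  of the first point, so do the iterates \<open>E n\<close> for all \<open>n \<le> K\<close>, whence \<open>Re (a * f)\<close> increases by
  nearly \<open>M\<close> each time. For large \<open>K\<close> this exceeds the oscillation of \<open>f\<close>.\<close>

lemma loop_invariant_Re:
  assumes y: "y \<in> C" and \<beta>: "walk y \<beta> y" and "x0 \<in> C" "e0 \<in> Fib x0 y"
  shows "Re (a * (f (transport \<beta> x0 e0) - f e0)) \<le> 0"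
proof (rule ccontr)
  define h where "h x e = Re (a * (f (transport \<beta> x e) - f e))" for x e
  assume "\<not> Re (a * (f (transport \<beta> x0 e0) - f e0)) \<le> 0"
  then have pos: "h x0 e0 > 0" by (simp add: h_def)
  define H where "H = {h x e | x e. x \<in> C \<and> e \<in> Fib x y}"
  define M where "M = Sup H"
  have T_in: "transport \<beta> x e \<in> Fib x y" if "x \<in> C" "e \<in> Fib x y" for x e
    using transport_in[OF \<beta> that(1), of e] that(2) Fib_sym by blast
  have f_Re: "Re (a * f e) \<le> norm a * B" "- (norm a * B) \<le> Re (a * f e)" if "e \<in> Fib x y" for x e
  proof -
    have "\<bar>Re (a * f e)\<bar> \<le> norm a * norm (f e)" by (metis abs_Re_le_cmod norm_mult)
    also have "\<dots> \<le> norm a * B" by (intro mult_left_mono f_bound[OF that]) auto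
    finally show "Re (a * f e) \<le> norm a * B" "- (norm a * B) \<le> Re (a * f e)" by linarith+
  qed
  have h_alt: "h x e = Re (a * f (transport \<beta> x e)) - Re (a * f e)" for x e
    by (simp add: h_def algebra_simps)
  have "h x e \<le> 2 * (norm a * B)" if "x \<in> C" "e \<in> Fib x y" for x e
    using f_Re[OF that(2)] f_Re[OF T_in[OF that]] by (simp add: h_alt)
  then have bdd: "bdd_above H" unfolding H_def by (auto intro!: bdd_aboveI[where M = "2 * (norm a * B)"])
  have h_le: "h x e \<le> M" if "x \<in> C" "e \<in> Fib x y" for x e
    unfolding M_def by (rule cSup_upper[OF _ bdd]) (use that in \<open>auto simp: H_def\<close>)
  have M: "M > 0" using h_le[of x0 e0] pos assms by auto
  obtain c where c: "c > 0" "\<And>x. x \<in> C \<Longrightarrow> \<exists>w. walk x w y \<and> walk_const w \<le> c"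
    using walk_uniform[OF y] by blast
  define k where "k = walk_const \<beta>"
  have k: "k \<ge> 1" using walk_const_ge_1[OF \<beta>] by (simp add: k_def)
  obtain K :: nat where K: "2 * (norm a * B) < (real K - 1) * M" "K \<ge> 1"
  proof -
    obtain K :: nat where "2 * (norm a * B) / M < real K" using reals_Archimedean2 by blast
    then have "2 * (norm a * B) < (real (Suc K) - 1) * M" using M by (simp add: field_simps)
    then show ?thesis using that[of "Suc K"] by simp
  qed
  \<comment> \<open>The walk to the diagonal costs a factor \<open>c\<close> and each of at most \<open>K\<close> iterations a factor \<open>k\<close>; with
    this \<open>\<delta>\<close> the total deficit over \<open>K\<close> iterations is at most \<open>M\<close>.\<close>
  define \<delta> where "\<delta> = M / (2 * c * K * k ^ K)"
  have \<delta>: "\<delta> > 0" using M c k K by (simp add: \<delta>_def)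
  have "\<exists>v\<in>H. M - \<delta> < v"
  proof -
    have "h x0 e0 \<in> H" using assms by (auto simp: H_def)
    then show ?thesis
      using less_cSup_iff[OF _ bdd, of "M - \<delta>"] \<delta> by (auto simp: M_def)
  qed
  then obtain x e where e: "x \<in> C" "e \<in> Fib x y" "M - \<delta> < h x e" by (auto simp: H_def)
  obtain w where w: "walk x w y" "walk_const w \<le> c" using c e by blast
  define q where "q x e = of_real (M + \<delta>) - a * (f (transport \<beta> x e) - f e)" for x e
  have q_Re: "Re (q x e) = M + \<delta> - h x e" for x e by (simp add: q_def h_def)
  have q_harnack: "Re (q x' (transport w y e)) \<le> walk_const w * Re (q x e)"
    if "walk x w x'" "x \<in> C" "e \<in> Fib x y" for x w x' e
  proof (rule harnack_walk[OF y, of "\<lambda>x. Fib x y"])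
    fix i z e
    assume i: "i \<in> I" "norm z < 1" "e \<in> Fib (pt i z) y"
    \<comment> \<open>The transformation commutes with the motion of the first point, hence \<open>q\<close> is holomorphic in it.\<close>
    have "transport \<beta> (pt i z') (t i z z' y e) = t i z z' y (transport \<beta> (pt i z) e)"
      if "norm z' < 1" for z'
      using transport_comm[OF \<beta>, of i z z' e] i y that Fib_sym by auto
    moreover have "(\<lambda>z'. of_real (M + \<delta>) - a * (f (t i z z' y (transport \<beta> (pt i z) e)) - f (t i z z' y e)))
        holomorphic_on ball 0 1"
      by (intro holomorphic_intros t_hol) (use i y T_in pt_in in auto)
    ultimately show "(\<lambda>z'. q (pt i z') (t i z z' y e)) holomorphic_on ball 0 1"
      unfolding q_def by (rule_tac holomorphic_transform) auto
  next
    show "Re (q x e) > 0" if "x \<in> C" "e \<in> Fib x y" for x e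
      using h_le[OF that] \<delta> by (simp add: q_Re)
  qed (use that t_in y in auto)
  define E where "E n = (transport \<beta> y ^^ n) (transport w y e)" for n
  have E_in: "E n \<in> Fib y y" for n
    by (induction n) (use transport_in[OF w(1) y e(2)] transport_in[OF \<beta> y] in \<open>auto simp: E_def\<close>)
  have E_q: "Re (q y (E n)) \<le> k ^ n * (2 * c * \<delta>)" for n
  proof (induction n)
    case 0
    have "Re (q y (E 0)) \<le> walk_const w * Re (q x e)"
      using q_harnack[OF w(1) e(1,2)] by (simp add: E_def)
    also have "\<dots> \<le> c * (2 * \<delta>)"
      using w(2) e h_le[OF e(1,2)] \<delta> c by (intro mult_mono) (auto simp: q_Re)
    finally show ?case by simp
  next
    case (Suc n)
    have "Re (q y (E (Suc n))) \<le> k * Re (q y (E n))"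
      using q_harnack[OF \<beta> y E_in[of n]] by (simp add: E_def k_def)
    also have "\<dots> \<le> k * (k ^ n * (2 * c * \<delta>))"
      using Suc k by (intro mult_left_mono) auto
    finally show ?case by simp
  qed
  have step: "M - M / K \<le> Re (a * f (E (Suc n))) - Re (a * f (E n))" if "n < K" for n
  proof -
    have "k ^ n * (2 * c * \<delta>) \<le> k ^ K * (2 * c * \<delta>)"
      using that k c \<delta> by (intro mult_right_mono power_increasing) auto
    also have "\<dots> = M / K" using k c K by (simp add: \<delta>_def)
    finally have "M + \<delta> - h y (E n) \<le> M / K" using E_q[of n] by (simp add: q_Re)
    then show ?thesis using \<delta> by (simp add: h_alt E_def)
  qed
  have "(real K - 1) * M = (\<Sum>n<K. M - M / K)"
    using K(2) by (simp add: right_diff_distrib left_diff_distrib)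
  also have "\<dots> \<le> (\<Sum>n<K. Re (a * f (E (Suc n))) - Re (a * f (E n)))"
    by (intro sum_mono step) auto
  also have "\<dots> = Re (a * f (E K)) - Re (a * f (E 0))"
    by (rule sum_lessThan_telescope)
  also have "\<dots> \<le> 2 * (norm a * B)"
    using f_Re[OF E_in[of K]] f_Re[OF E_in[of 0]] by linarith
  finally have "(real K - 1) * M \<le> 2 * (norm a * B)" .
  then show False using K(1) by simp
qed

lemma eq_if_Re_mult_le:
  assumes "\<And>a. Re (a * (u - v)) \<le> 0"
  shows "u = (v :: complex)"
proof -
  have "(norm (u - v))\<^sup>2 \<le> 0"
    using assms[of "cnj (u - v)"] unfolding cmod_power2 by (simp add: power2_eq_square algebra_simps)
  then show ?thesis by simp
qed

lemma loop_invariant: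
  assumes "y \<in> C" "walk y \<beta> y" "x \<in> C" "e \<in> Fib x y"
  shows "f (transport \<beta> x e) = f e"
  using loop_invariant_Re[OF assms] by (rule eq_if_Re_mult_le)

text \<open>Let \<open>S\<close> be the set of all points reached from \<open>e0\<close>. On the part of \<open>S\<close> over \<open>x = y\<close> the function
  \<open>f\<close> has the value \<open>f e0\<close> by the previous lemma, and Harnack's inequality compares every other point
  of \<open>S\<close> with that part, so that \<open>Re (a * f e0)\<close> is the supremum of \<open>Re (a * f)\<close> on \<open>S\<close>.\<close>

lemma walk_invariant_diagonal:
  assumes y: "y \<in> C" and e0: "e0 \<in> Fib y y" and "walk y w0 x0"
  shows "f (transport w0 y e0) = f e0"
proof (rule eq_if_Re_mult_le)
  fix a
  define S where "S x = {transport w y e0 | w. walk y w x}" for x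
  define H where "H = {Re (a * f e) | x e. e \<in> S x}"
  define M where "M = Sup H"
  have S_sub: "S x \<subseteq> Fib x y" for x
    using transport_in[OF _ y e0] by (auto simp: S_def)
  have S_C: "x \<in> C" if "e \<in> S x" for e x
    using that y walk_in by (auto simp: S_def)
  have S_walk: "transport w y e \<in> S x'" if w: "walk x w x'" and e: "e \<in> S x" for x w x' e
  proof -
    obtain v where v: "walk y v x" "e = transport v y e0" using e by (auto simp: S_def)
    then have "walk y (v @ w) x'" "transport w y e = transport (v @ w) y e0"
      using w by (auto simp: walk_append transport_append)
    then show ?thesis by (auto simp: S_def)
  qed
  have S_t: "t i z z' y e \<in> S (pt i z')" if "i \<in> I" "norm z < 1" "norm z' < 1" "e \<in> S (pt i z)"
    for i z z' e
    using S_walk[of "pt i z" "[(i, z, z')]" "pt i z'" e] that by simp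
  have S_diag: "f e = f e0" if "e \<in> S y" for e
    using that loop_invariant[OF y _ y e0] by (auto simp: S_def)
  have "Re (a * f e) \<le> norm a * B" if "e \<in> S x" for x e
  proof -
    have "Re (a * f e) \<le> norm a * norm (f e)" by (metis complex_Re_le_cmod norm_mult)
    also have "\<dots> \<le> norm a * B" using that S_sub by (intro mult_left_mono f_bound) auto
    finally show ?thesis .
  qed
  then have bdd: "bdd_above H" unfolding H_def by (auto intro!: bdd_aboveI[where M = "norm a * B"])
  have H_le: "Re (a * f e) \<le> M" if "e \<in> S x" for x e
    unfolding M_def by (rule cSup_upper[OF _ bdd]) (use that in \<open>auto simp: H_def\<close>)
  obtain c where c: "c > 0" "\<And>x. x \<in> C \<Longrightarrow> \<exists>w. walk x w y \<and> walk_const w \<le> c"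
    using walk_uniform[OF y] by blast
  have M_le: "M - Re (a * f e0) \<le> c * (2 * \<delta>)" if \<delta>: "\<delta> > 0" for \<delta>
  proof -
    have "\<exists>v\<in>H. M - \<delta> < v"
    proof -
      have "H \<noteq> {}" using assms(3) by (auto simp: H_def S_def)
      then show ?thesis
        using less_cSup_iff[OF _ bdd, of "M - \<delta>"] \<delta> by (auto simp: M_def)
    qed
    then obtain x e where e: "e \<in> S x" "M - \<delta> < Re (a * f e)" by (auto simp: H_def)
    obtain w where w: "walk x w y" "walk_const w \<le> c" using c S_C[OF e(1)] by blast
    define q where "q x e = of_real (M + \<delta>) - a * f e" for x :: 'a and e
    have "Re (q y (transport w y e)) \<le> walk_const w * Re (q x e)"
    proof (rule harnack_walk[OF y, of S])
      fix i z e
      assume "i \<in> I" "norm z < 1" "e \<in> S (pt i z)"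
      then show "(\<lambda>z'. q (pt i z') (t i z z' y e)) holomorphic_on ball 0 1"
        unfolding q_def by (intro holomorphic_intros t_hol) (use y S_sub in auto)
    next
      show "Re (q x e) > 0" if "e \<in> S x" for x e using H_le[OF that] \<delta> by (simp add: q_def)
    qed (use S_sub S_t w e S_C in auto)
    also have "\<dots> \<le> c * (2 * \<delta>)"
      using w(2) e H_le[OF e(1)] \<delta> c by (intro mult_mono) (auto simp: q_def)
    finally show ?thesis
      using \<delta> S_diag[OF S_walk[OF w(1) e(1)]] by (simp add: q_def)
  qed
  have "M - Re (a * f e0) \<le> 0 + \<epsilon>" if "\<epsilon> > 0" for \<epsilon>
    using M_le[of "\<epsilon> / (2 * c)"] that c by simp
  then have "M \<le> Re (a * f e0)" using field_le_epsilon[of "M - Re (a * f e0)" 0] by simp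
  moreover have "Re (a * f (transport w0 y e0)) \<le> M"
    by (rule H_le[of _ x0]) (use assms(3) in \<open>auto simp: S_def\<close>)
  ultimately show "Re (a * (f (transport w0 y e0) - f e0)) \<le> 0" by (simp add: algebra_simps)
qed

text \<open>Every point is reached by a walk from a point over \<open>x = y\<close>, namely by reversing a walk that leads
  there.\<close>

theorem transport_invariant:
  assumes i: "i \<in> I" "norm z < 1" "norm z' < 1" and y: "y \<in> C" and e: "e \<in> Fib (pt i z) y"
  shows "f (t i z z' y e) = f e"
proof -
  obtain w where w: "walk (pt i z) w y" using walk_exists pt_in i y by blast
  define e1 where "e1 = transport w y e"
  have e1: "e1 \<in> Fib y y" unfolding e1_def by (rule transport_in[OF w y e])
  obtain v where v: "walk y v (pt i z)" "transport v y e1 = e"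
    using walk_back[OF w y] e by (auto simp: e1_def)
  have "f (transport (v @ [(i, z, z')]) y e1) = f e1"
    by (rule walk_invariant_diagonal[OF y e1, of _ "pt i z'"]) (use v i in \<open>auto simp: walk_append\<close>)
  moreover have "f (transport v y e1) = f e1"
    by (rule walk_invariant_diagonal[OF y e1 v(1)])
  ultimately show ?thesis using v by (simp add: transport_append)
qed

end

section \<open>Sections and lifts of coverings\<close>

text \<open>The two consequences of a decomposition into disjoint sheets on which lifting arguments rely:
  sections through given points, and separation of different points of a fibre.\<close>

definition evenly_covered :: "'e topology \<Rightarrow> ('e \<Rightarrow> 'a) \<Rightarrow> 'a topology \<Rightarrow> 'a set \<Rightarrow> bool"
  where "evenly_covered T p X U \<longleftrightarrow> openin X U \<and>
    (\<forall>e\<in>topspace T. p e \<in> U \<longrightarrow> (\<exists>V. openin T V \<and> e \<in> V \<and>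
      homeomorphic_map (subtopology T V) (subtopology X U) p)) \<and>
    (\<forall>e\<in>topspace T. \<forall>e'\<in>topspace T. p e = p e' \<and> p e \<in> U \<and> e \<noteq> e' \<longrightarrow>
      (\<exists>V V'. openin T V \<and> openin T V' \<and> e \<in> V \<and> e' \<in> V' \<and> disjnt V V'))"

lemma covering_map_evenly_covered:
  assumes "covering_map T p X" "x \<in> topspace X"
  obtains U where "x \<in> U" "evenly_covered T p X U"
proof -
  obtain U \<V> where U: "x \<in> U" "openin X U"
    and \<V>: "\<Union>\<V> = {e \<in> topspace T. p e \<in> U}" "\<And>V. V \<in> \<V> \<Longrightarrow> openin T V" "pairwise disjnt \<V>"
      "\<And>V. V \<in> \<V> \<Longrightarrow> homeomorphic_map (subtopology T V) (subtopology X U) p"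
    using assms unfolding covering_map_def by meson
  have "evenly_covered T p X U"
    unfolding evenly_covered_def
  proof (intro conjI ballI impI)
    fix e assume "e \<in> topspace T" "p e \<in> U"
    then show "\<exists>V. openin T V \<and> e \<in> V \<and> homeomorphic_map (subtopology T V) (subtopology X U) p"
      using \<V> by blast
  next
    fix e e' assume e: "e \<in> topspace T" "e' \<in> topspace T" "p e = p e' \<and> p e \<in> U \<and> e \<noteq> e'"
    then have "e \<in> \<Union>\<V>" "e' \<in> \<Union>\<V>" unfolding \<V>(1) by auto
    then obtain V V' where V: "V \<in> \<V>" "e \<in> V" "V' \<in> \<V>" "e' \<in> V'" by blast
    have "V \<noteq> V'"
    proof
      assume "V = V'"
      moreover have "inj_on p V"
        using homeomorphic_imp_injective_map[OF \<V>(4)[OF V(1)]] openin_subset[OF \<V>(2)[OF V(1)]]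
        by (simp add: Int_absorb1)
      ultimately show False using e V by (auto dest: inj_onD)
    qed
    then show "\<exists>V V'. openin T V \<and> openin T V' \<and> e \<in> V \<and> e' \<in> V' \<and> disjnt V V'"
      using V \<V>(2,3) by (metis pairwiseD)
  qed (rule U)
  then show ?thesis using that U by blast
qed

lemma evenly_covered_section:
  assumes ev: "evenly_covered T p X U" and e: "e \<in> topspace T" "p e \<in> U"
  obtains V r where "openin T V" "e \<in> V" "continuous_map (subtopology X U) T r"
    "\<forall>x\<in>U. p (r x) = x" "\<forall>e'\<in>V. r (p e') = e'"
proof -
  obtain V where V: "openin T V" "e \<in> V" "homeomorphic_map (subtopology T V) (subtopology X U) p"
    using ev e unfolding evenly_covered_def by blast
  then obtain r where r: "homeomorphic_maps (subtopology T V) (subtopology X U) p r"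
    using homeomorphic_map_maps by blast
  have VT: "V \<subseteq> topspace T" using V openin_subset by blast
  have UX: "U \<subseteq> topspace X" using ev openin_subset unfolding evenly_covered_def by blast
  have "continuous_map (subtopology X U) (subtopology T V) r"
    and "\<forall>x\<in>U. p (r x) = x" "\<forall>e\<in>V. r (p e) = e"
    using r VT UX unfolding homeomorphic_maps_def by (auto simp: Int_absorb1)
  then show ?thesis using that V continuous_map_into_fulltopology by blast
qed

lemma lift_exists:
  assumes ev: "evenly_covered T p X U"
    and c: "continuous_map M X c" "c ` topspace M \<subseteq> U"
    and e: "e \<in> topspace T" "z \<in> topspace M" "p e = c z"
  obtains s where "continuous_map M T s" "\<forall>w\<in>topspace M. p (s w) = c w" "s z = e"
proof -
  have pU: "p e \<in> U" using e c by auto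
  obtain V r where V: "openin T V" "e \<in> V" and r: "continuous_map (subtopology X U) T r"
      "\<forall>x\<in>U. p (r x) = x" "\<forall>e'\<in>V. r (p e') = e'"
    using evenly_covered_section[where p = p, OF ev e(1) pU] .
  have "continuous_map M (subtopology X U) c"
    using c by (auto simp: continuous_map_in_subtopology)
  then have "continuous_map M T (r \<circ> c)"
    using r(1) continuous_map_compose by blast
  then show ?thesis
    by (rule that) (use c(2) r(2) r(3) V(2) e in auto)
qed

text \<open>The set where two lifts agree is open as \<open>p\<close> is injective on sheets, and closed as different points
  of a fibre lie in disjoint sheets.\<close>

lemma lift_unique:
  assumes cov: "covering_map T p X" and M: "connected_space M"
    and s: "continuous_map M T s" and s': "continuous_map M T s'"
    and eq: "\<And>w. w \<in> topspace M \<Longrightarrow> p (s w) = p (s' w)"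
    and z: "z \<in> topspace M" "s z = s' z" and w: "w \<in> topspace M"
  shows "s w = s' w"
proof -
  let ?A = "{w \<in> topspace M. s w = s' w}"
  have s_in: "s w \<in> topspace T" "s' w \<in> topspace T" if "w \<in> topspace M" for w
    using that s s' by (auto simp: continuous_map_def)
  have px: "p (s w) \<in> topspace X" if "w \<in> topspace M" for w
    using cov s_in[OF that] unfolding covering_map_def by blast
  have "openin M ?A"
  proof (subst openin_subopen, intro ballI)
    fix w assume w: "w \<in> ?A"
    obtain U where U: "p (s w) \<in> U" "evenly_covered T p X U"
      using covering_map_evenly_covered[OF cov px] w by blast
    then obtain V where V: "openin T V" "s w \<in> V" "homeomorphic_map (subtopology T V) (subtopology X U) p"
      using s_in w unfolding evenly_covered_def by blast
    have inj: "inj_on p V"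
      using homeomorphic_imp_injective_map[OF V(3)] openin_subset[OF V(1)]
      by (simp add: Int_absorb1)
    let ?N = "{u \<in> topspace M. s u \<in> V} \<inter> {u \<in> topspace M. s' u \<in> V}"
    have "openin M ?N"
      by (intro openin_Int openin_continuous_map_preimage[OF s] openin_continuous_map_preimage[OF s'] V)
    moreover have "w \<in> ?N" using w V by auto
    moreover have "?N \<subseteq> ?A" using inj eq by (auto dest: inj_onD)
    ultimately show "\<exists>N. openin M N \<and> w \<in> N \<and> N \<subseteq> ?A" by blast
  qed
  moreover have "openin M (topspace M - ?A)"
  proof (subst openin_subopen, intro ballI)
    fix w assume w: "w \<in> topspace M - ?A"
    obtain U where U: "p (s w) \<in> U" "evenly_covered T p X U"
      using covering_map_evenly_covered[OF cov px] w by blast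
    have "s w \<in> topspace T" "s' w \<in> topspace T" "p (s w) = p (s' w) \<and> p (s w) \<in> U \<and> s w \<noteq> s' w"
      using w s_in eq U(1) by auto
    then obtain V V' where V: "openin T V" "openin T V'" "s w \<in> V" "s' w \<in> V'" "disjnt V V'"
      using U(2) unfolding evenly_covered_def by blast
    let ?N = "{u \<in> topspace M. s u \<in> V} \<inter> {u \<in> topspace M. s' u \<in> V'}"
    have "openin M ?N"
      by (intro openin_Int openin_continuous_map_preimage[OF s] openin_continuous_map_preimage[OF s'] V)
    moreover have "w \<in> ?N" using w V by auto
    moreover have "?N \<subseteq> topspace M - ?A" using V by (auto simp: disjnt_iff)
    ultimately show "\<exists>N. openin M N \<and> w \<in> N \<and> N \<subseteq> topspace M - ?A" by blast
  qed
  ultimately have "?A = {} \<or> ?A = topspace M"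
    using M unfolding connected_space_clopen_in closedin_def by blast
  then show ?thesis using z w by blast
qed

section \<open>Polynomials on the cone over a projective variety\<close>

lemma mem_proj_point: "v \<in> proj_point x \<longleftrightarrow> (\<exists>c. v = c *s x)"
  by (auto simp: proj_point_def vec.span_singleton)

lemma proj_point_self: "x \<in> proj_point x"
  by (auto simp: mem_proj_point intro: exI[of _ 1])

lemma proj_point_scale: "c \<noteq> 0 \<Longrightarrow> proj_point (c *s x) = proj_point x"
proof (intro set_eqI)
  fix v assume c: "c \<noteq> 0"
  have "v = (d / c) *s (c *s x) \<longleftrightarrow> v = d *s x" for d using c by simp
  then show "v \<in> proj_point (c *s x) \<longleftrightarrow> v \<in> proj_point x"
    unfolding mem_proj_point by (metis vec.scale_scale)
qed

lemma proj_point_eqD: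
  assumes "proj_point y = proj_point x" "y \<noteq> 0"
  obtains c where "c \<noteq> 0" "y = c *s x"
proof -
  have "y \<in> proj_point x" using assms proj_point_self by blast
  then obtain c where c: "y = c *s x" by (auto simp: mem_proj_point)
  then have "c \<noteq> 0" using assms(2) by auto
  then show ?thesis using that c by blast
qed

text \<open>The derivative \<open>f' x\<close> at \<open>x\<close> is named because the inverse function theorem needs its continuity
  in \<open>x\<close> and the inverse is holomorphic only by its complex linearity.\<close>

definition entire_with :: "(complex ^ 'n \<Rightarrow> complex) \<Rightarrow> (complex ^ 'n \<Rightarrow> complex ^ 'n \<Rightarrow> complex) \<Rightarrow> bool"
  where "entire_with f f' \<longleftrightarrow> (\<forall>x. (f has_derivative f' x) (at x)) \<and>
    (\<forall>h. continuous_on UNIV (\<lambda>x. f' x h)) \<and> (\<forall>x c h. f' x (c *s h) = c * f' x h)"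

lemma entire_with_continuous: "entire_with f f' \<Longrightarrow> continuous_on UNIV f"
  unfolding entire_with_def
  by (meson continuous_at_imp_continuous_on has_derivative_continuous)

lemma entire_with_const: "entire_with (\<lambda>_. c) (\<lambda>_ _. 0)"
  by (simp add: entire_with_def)

lemma entire_with_nth: "entire_with (\<lambda>x. x $ i) (\<lambda>_ h. h $ i)"
  unfolding entire_with_def
  by (simp add: bounded_linear_imp_has_derivative bounded_linear_vec_nth)

lemma entire_with_mult:
  assumes "entire_with f f'" "entire_with g g'"
  shows "entire_with (\<lambda>x. f x * g x) (\<lambda>x h. f x * g' x h + f' x h * g x)"
  unfolding entire_with_def
proof (intro conjI allI)
  show "((\<lambda>x. f x * g x) has_derivative (\<lambda>h. f x * g' x h + f' x h * g x)) (at x)" for x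
    by (rule has_derivative_mult) (use assms in \<open>auto simp: entire_with_def\<close>)
  show "continuous_on UNIV (\<lambda>x. f x * g' x h + f' x h * g x)" for h
    by (intro continuous_on_add continuous_on_mult entire_with_continuous[OF assms(1)]
        entire_with_continuous[OF assms(2)]) (use assms in \<open>auto simp: entire_with_def\<close>)
  show "f x * g' x (c *s h) + f' x (c *s h) * g x = c * (f x * g' x h + f' x h * g x)" for x c h
    using assms by (simp add: entire_with_def algebra_simps)
qed

lemma entire_with_sum:
  assumes "\<And>a. a \<in> A \<Longrightarrow> entire_with (f a) (f' a)"
  shows "entire_with (\<lambda>x. \<Sum>a\<in>A. f a x) (\<lambda>x h. \<Sum>a\<in>A. f' a x h)"
  unfolding entire_with_def
proof (intro conjI allI)
  show "((\<lambda>x. \<Sum>a\<in>A. f a x) has_derivative (\<lambda>h. \<Sum>a\<in>A. f' a x h)) (at x)" for x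
    by (rule has_derivative_sum) (use assms in \<open>auto simp: entire_with_def\<close>)
  show "continuous_on UNIV (\<lambda>x. \<Sum>a\<in>A. f' a x h)" for h
    by (rule continuous_on_sum) (use assms in \<open>auto simp: entire_with_def\<close>)
  show "(\<Sum>a\<in>A. f' a x (c *s h)) = c * (\<Sum>a\<in>A. f' a x h)" for x c h
    unfolding sum_distrib_left by (rule sum.cong) (use assms in \<open>auto simp: entire_with_def\<close>)
qed

lemma entire_power:
  assumes "entire_with f f'"
  shows "\<exists>g. entire_with (\<lambda>x. f x ^ k) g"
proof (induction k)
  case 0
  show ?case using entire_with_const[of 1] by auto
next
  case (Suc k)
  then obtain g where "entire_with (\<lambda>x. f x ^ k) g" ..
  from entire_with_mult[OF assms this] show ?case by auto
qed

lemma entire_prod: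
  "finite A \<Longrightarrow> (\<And>a. a \<in> A \<Longrightarrow> \<exists>g. entire_with (f a) g) \<Longrightarrow> \<exists>g. entire_with (\<lambda>x. \<Prod>a\<in>A. f a x) g"
proof (induction A rule: finite_induct)
  case empty
  then show ?case by (auto intro: entire_with_const)
next
  case (insert a A)
  obtain g where g: "entire_with (f a) g" using insert.prems by blast
  obtain h where h: "entire_with (\<lambda>x. \<Prod>a\<in>A. f a x) h" using insert by blast
  from entire_with_mult[OF g h] insert.hyps show ?case by auto
qed

lemma homogeneous_poly_entire:
  fixes f :: "complex ^ 'n \<Rightarrow> complex"
  assumes "homogeneous_poly k f"
  shows "\<exists>f'. entire_with f f'"
proof -
  obtain c where f: "f = (\<lambda>x. \<Sum>a | sum a UNIV = k. c a * (\<Prod>i\<in>UNIV. x $ i ^ a i))"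
    using assms by (auto simp: homogeneous_poly_def)
  have "\<forall>a. \<exists>g. entire_with (\<lambda>x :: complex ^ 'n. c a * (\<Prod>i\<in>UNIV. x $ i ^ a i)) g"
  proof
    fix a
    have "\<exists>g. entire_with (\<lambda>x :: complex ^ 'n. \<Prod>i\<in>UNIV. x $ i ^ a i) g"
      by (intro entire_prod finite) (rule entire_power, rule entire_with_nth)
    then obtain g where g: "entire_with (\<lambda>x. \<Prod>i\<in>UNIV. x $ i ^ a i) g" ..
    show "\<exists>g. entire_with (\<lambda>x. c a * (\<Prod>i\<in>UNIV. x $ i ^ a i)) g"
      by (rule exI, rule entire_with_mult[OF entire_with_const g])
  qed
  from choice[OF this] obtain g
    where g: "\<forall>a. entire_with (\<lambda>x. c a * (\<Prod>i\<in>UNIV. x $ i ^ a i)) (g a)" ..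
  show ?thesis unfolding f by (rule exI, rule entire_with_sum) (rule g[rule_format])
qed

lemma homogeneous_poly_scale:
  assumes "homogeneous_poly k f"
  shows "f (c *s x) = c ^ k * f x"
proof -
  obtain b where f: "f = (\<lambda>x. \<Sum>a | sum a UNIV = k. b a * (\<Prod>i\<in>UNIV. x $ i ^ a i))"
    using assms by (auto simp: homogeneous_poly_def)
  have "b a * (\<Prod>i\<in>UNIV. (c *s x) $ i ^ a i) = c ^ k * (b a * (\<Prod>i\<in>UNIV. x $ i ^ a i))"
    if "sum a UNIV = k" for a
  proof -
    have "(\<Prod>i\<in>UNIV. (c *s x) $ i ^ a i) = c ^ sum a UNIV * (\<Prod>i\<in>UNIV. x $ i ^ a i)"
      by (simp add: power_mult_distrib prod.distrib power_sum)
    then show ?thesis using that by simp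
  qed
  then show ?thesis unfolding f sum_distrib_left by (intro sum.cong) auto
qed

lemma mem_proj_zeros:
  assumes "\<And>f. f \<in> F \<Longrightarrow> \<exists>k. homogeneous_poly k f" "v \<noteq> 0"
  shows "proj_point v \<in> proj_zeros F \<longleftrightarrow> (\<forall>f\<in>F. f v = 0)"
proof
  assume "proj_point v \<in> proj_zeros F"
  then show "\<forall>f\<in>F. f v = 0" using proj_point_self by (auto simp: proj_zeros_def)
next
  assume v: "\<forall>f\<in>F. f v = 0"
  have "f x = 0" if f: "f \<in> F" and "x \<in> proj_point v" for f x
  proof -
    obtain k where k: "homogeneous_poly k f" using assms(1)[OF f] by blast
    then show ?thesis using that v by (auto simp: mem_proj_point homogeneous_poly_scale[OF k])
  qed
  then show "proj_point v \<in> proj_zeros F" using assms(2) by (auto simp: proj_zeros_def proj_space_def)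
qed

definition affine_cone :: "(complex ^ 'n) set set \<Rightarrow> (complex ^ 'n) set"
  where "affine_cone C = {v. v \<noteq> 0 \<and> proj_point v \<in> C}"

lemma affine_cone_scale: "v \<in> affine_cone C \<Longrightarrow> c \<noteq> 0 \<Longrightarrow> c *s v \<in> affine_cone C"
  by (simp add: affine_cone_def proj_point_scale)

lemma bounded_linear_scale_vec: "bounded_linear (\<lambda>c::complex. c *s (r :: complex ^ 'n))"
  unfolding linear_conv_bounded_linear[symmetric]
  by (rule linearI) (auto simp: vec_eq_iff algebra_simps)

text \<open>These maps behave like those whose components belong to the ideal of \<open>C\<close>, and they are closed under
  composition with linear maps from the left.\<close>

definition ideal_map ::
  "(complex ^ 'n) set set \<Rightarrow> (complex ^ 'n \<Rightarrow> complex ^ 'n) \<Rightarrow>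
    (complex ^ 'n \<Rightarrow> complex ^ 'n \<Rightarrow> complex ^ 'n) \<Rightarrow> bool"
  where "ideal_map C P P' \<longleftrightarrow> (\<forall>x. (P has_derivative P' x) (at x)) \<and>
    (\<forall>h. continuous_on UNIV (\<lambda>x. P' x h)) \<and> (\<forall>x c h. P' x (c *s h) = c *s P' x h) \<and>
    (\<forall>v\<in>affine_cone C. P v = 0)"

text \<open>If \<open>f' x r = 1\<close>, then \<open>f' x\<close> vanishes on the range of \<open>\<lambda>h. h - Q h\<close>, where \<open>Q\<close> is the derivative of the
  modified map at \<open>x\<close>.\<close>

lemma ideal_map_modify:
  assumes P: "ideal_map C P P'" and f: "entire_with f f'" and f0: "\<And>v. v \<in> affine_cone C \<Longrightarrow> f v = 0"
  shows "ideal_map C (\<lambda>v. P v + (f v - f' x (P v)) *s r) (\<lambda>v h. P' v h + (f' v h - f' x (P' v h)) *s r)"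
proof -
  have bl: "bounded_linear (f' x)" using f has_derivative_bounded_linear unfolding entire_with_def by blast
  have "((\<lambda>v. P v + (f v - f' x (P v)) *s r) has_derivative
      (\<lambda>h. P' v h + (f' v h - f' x (P' v h)) *s r)) (at v)" for v
    by (intro has_derivative_add has_derivative_diff bounded_linear.has_derivative[OF bounded_linear_scale_vec]
        bounded_linear.has_derivative[OF bl]) (use P f in \<open>auto simp: ideal_map_def entire_with_def\<close>)
  moreover have "continuous_on UNIV (\<lambda>v. P' v h + (f' v h - f' x (P' v h)) *s r)" for h
    by (intro continuous_on_add continuous_on_diff bounded_linear.continuous_on[OF bounded_linear_scale_vec]
        bounded_linear.continuous_on[OF bl]) (use P f in \<open>auto simp: ideal_map_def entire_with_def\<close>)
  moreover have "P' v (c *s h) + (f' v (c *s h) - f' x (P' v (c *s h))) *s r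
      = c *s (P' v h + (f' v h - f' x (P' v h)) *s r)" for v c h
  proof -
    have *: "P' v (c *s h) = c *s P' v h" "f' v (c *s h) = c * f' v h" "f' x (c *s u) = c * f' x u" for u
      using P f by (simp_all add: ideal_map_def entire_with_def)
    show ?thesis unfolding * by (simp add: vec_eq_iff algebra_simps)
  qed
  moreover have "f' x 0 = 0" using bl linear_0 bounded_linear.linear by blast
  ultimately show ?thesis
    using P f0 unfolding ideal_map_def by simp
qed

lemma cone_tangent_deriv:
  assumes "entire_with f f'"
  shows "deriv (\<lambda>t. f (x + t *s v)) 0 = f' x v"
proof -
  have f': "(f has_derivative f' x) (at (x + 0 *s v))" "\<And>c h. f' x (c *s h) = c * f' x h"
    using assms by (auto simp: entire_with_def)
  have "((\<lambda>t. x + t *s v) has_derivative (\<lambda>t. t *s v)) (at 0)"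
    by (auto intro!: derivative_eq_intros bounded_linear.has_derivative[OF bounded_linear_scale_vec])
  from has_derivative_compose[OF this f'(1)]
  have "((\<lambda>t. f (x + t *s v)) has_derivative (\<lambda>t. t * f' x v)) (at 0)"
    by (simp add: f'(2))
  then have "((\<lambda>t. f (x + t *s v)) has_field_derivative f' x v) (at 0)"
    by (simp add: has_field_derivative_def mult_commute_abs)
  then show ?thesis by (rule DERIV_imp_deriv)
qed

text \<open>The derivative of \<open>P\<close> at \<open>x\<close> is to be the identity modulo the tangent space. Choose
  \<open>P\<close> such that the range of \<open>\<lambda>h. h - P' x h\<close> has the least dimension. If this range contained a
  vector \<open>r\<close> outside the tangent space, some polynomial \<open>f\<close> of the ideal would have \<open>f' x r \<noteq> 0\<close>, and
  modifying \<open>P\<close> by \<open>f\<close> would make the range smaller.\<close>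

lemma ideal_map_exists:
  assumes x: "x \<in> affine_cone C"
  obtains P P' where "ideal_map C P P'" "\<And>h. h - P' x h \<in> cone_tangent C x"
proof -
  let ?R = "\<lambda>P'. range (\<lambda>h. h - P' x h)"
  have "ideal_map C (\<lambda>_. 0) (\<lambda>_ _. 0)" by (simp add: ideal_map_def)
  then have "ideal_map C (fst ((\<lambda>_. 0), (\<lambda>_ _. 0))) (snd ((\<lambda>_. 0), (\<lambda>_ _. 0)))" by simp
  from ex_has_least_nat[where P = "\<lambda>Q. ideal_map C (fst Q) (snd Q)" and
      m = "\<lambda>Q. vec.dim (?R (snd Q))", OF this]
  obtain PP where PP: "ideal_map C (fst PP) (snd PP)"
    and PP_least: "\<forall>Q. ideal_map C (fst Q) (snd Q) \<longrightarrow> vec.dim (?R (snd PP)) \<le> vec.dim (?R (snd Q))"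
    by blast
  define P P' where "P = fst PP" and "P' = snd PP"
  have P: "ideal_map C P P'" using PP by (simp add: P_def P'_def)
  have least: "vec.dim (?R P') \<le> vec.dim (?R Q')" if "ideal_map C Q Q'" for Q Q'
    using PP_least[rule_format, of "(Q, Q')"] that by (simp add: P'_def)
  have sub: "vec.subspace (?R Q')" if Q: "ideal_map C Q Q'" for Q Q'
  proof (intro vec.subspaceI)
    have "bounded_linear (Q' x)" using Q has_derivative_bounded_linear unfolding ideal_map_def by blast
    then have lin: "linear (Q' x)" by (rule bounded_linear.linear)
    have Qs: "Q' x (c *s h) = c *s Q' x h" for c h using Q by (simp add: ideal_map_def)
    show "0 \<in> ?R Q'" using linear_0[OF lin] by (auto intro!: image_eqI[of _ _ 0])
    show "u + v \<in> ?R Q'" if u: "u \<in> ?R Q'" and v: "v \<in> ?R Q'" for u v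
    proof -
      obtain a b where "u = a - Q' x a" "v = b - Q' x b" using u v by auto
      then have "u + v = (a + b) - Q' x (a + b)" by (simp add: linear_add[OF lin])
      then show ?thesis by blast
    qed
    show "c *s u \<in> ?R Q'" if u: "u \<in> ?R Q'" for c u
    proof -
      obtain a where "u = a - Q' x a" using u by auto
      then have "c *s u = (c *s a) - Q' x (c *s a)" by (simp add: Qs vec.scale_right_diff_distrib)
      then show ?thesis by blast
    qed
  qed
  have "h - P' x h \<in> cone_tangent C x" for h
  proof (rule ccontr)
    define r where "r = h - P' x h"
    assume "h - P' x h \<notin> cone_tangent C x"
    then obtain k f where f: "homogeneous_poly k f" "\<And>L y. L \<in> C \<Longrightarrow> y \<in> L \<Longrightarrow> f y = 0"
      "deriv (\<lambda>t. f (x + t *s r)) 0 \<noteq> 0" by (auto simp: cone_tangent_def r_def)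
    obtain f' where f': "entire_with f f'" using homogeneous_poly_entire[OF f(1)] by blast
    have fr: "f' x r \<noteq> 0" using f(3) cone_tangent_deriv[OF f'] by simp
    have fs: "f' x (c *s h) = c * f' x h" for c h using f' by (simp add: entire_with_def)
    have "bounded_linear (f' x)" using f' has_derivative_bounded_linear unfolding entire_with_def by blast
    then have lin: "linear (f' x)" by (rule bounded_linear.linear)
    define r' where "r' = (1 / f' x r) *s r"
    have fr': "f' x r' = 1" using fr by (simp add: r'_def fs)
    define Q' where "Q' v h = P' v h + (f' v h - f' x (P' v h)) *s r'" for v h
    have Q: "ideal_map C (\<lambda>v. P v + (f v - f' x (P v)) *s r') Q'"
      unfolding Q'_def
      by (rule ideal_map_modify[OF P f']) (use f proj_point_self in \<open>auto simp: affine_cone_def\<close>)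
    have rS: "r \<in> ?R P'" by (auto simp: r_def)
    then have r'S: "r' \<in> ?R P'" unfolding r'_def by (rule vec.subspace_scale[OF sub[OF P]])
    have "?R Q' \<subseteq> {s \<in> ?R P'. f' x s = 0}"
    proof clarify
      fix h
      let ?s = "h - P' x h"
      have "h - Q' x h = ?s - f' x ?s *s r'" by (simp add: Q'_def linear_diff[OF lin])
      moreover have "f' x (?s - f' x ?s *s r') = 0" by (simp add: linear_diff[OF lin] fs fr')
      moreover have "?s - f' x ?s *s r' \<in> ?R P'"
        by (rule vec.subspace_diff[OF sub[OF P] _ vec.subspace_scale[OF sub[OF P] r'S]]) blast
      ultimately show "h - Q' x h \<in> ?R P' \<and> f' x (h - Q' x h) = 0" by metis
    qed
    then have "?R Q' \<subset> ?R P'" using rS fr by blast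
    moreover have "vec.span (?R Q') = ?R Q'" "vec.span (?R P') = ?R P'"
      using sub[OF P] sub[OF Q] vec.span_eq_iff by blast+
    ultimately have "vec.span (?R Q') \<subset> vec.span (?R P')" by (simp only:)
    then have "vec.dim (?R Q') < vec.dim (?R P')" by (rule vec.dim_psubset)
    then show False using least[OF Q] by simp
  qed
  then show ?thesis using that P by blast
qed

lemma cone_tangent_self:
  fixes x :: "complex ^ 'n"
  assumes x: "x \<in> affine_cone C"
  shows "x \<in> cone_tangent C x"
proof -
  have "f (x + t *s x) = 0" if "\<forall>L\<in>C. \<forall>y\<in>L. f y = 0" for f :: "complex ^ 'n \<Rightarrow> complex" and t
  proof -
    have "x + t *s x = (1 + t) *s x" by (simp add: vec.scale_left_distrib)
    then have "x + t *s x \<in> proj_point x" unfolding mem_proj_point by blast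
    then show ?thesis using that x by (auto simp: affine_cone_def)
  qed
  then have "(\<lambda>t. f (x + t *s x)) = (\<lambda>_. 0)" if "\<forall>L\<in>C. \<forall>y\<in>L. f y = 0"
    for f :: "complex ^ 'n \<Rightarrow> complex" using that by blast
  then show ?thesis by (auto simp: cone_tangent_def)
qed

text \<open>The normalisation \<open>w $ j = 0\<close> makes the first coordinate of \<open>v\<close> equal to \<open>v $ j / x $ j\<close>, visibly a
  continuous function.\<close>

lemma two_dim_basis:
  fixes W :: "(complex ^ 'n) set" and x :: "complex ^ 'n"
  assumes "vec.dim W = 2" "x \<in> W" "x $ j \<noteq> 0"
  obtains w :: "complex ^ 'n" where "w \<noteq> 0" "w $ j = 0" "\<And>v. v \<in> W \<Longrightarrow> \<exists>a b. v = a *s x + b *s w"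
proof -
  have x: "x \<noteq> 0" using assms by auto
  then have "vec.independent {x}" by (simp add: vec.dependent_single)
  with assms obtain B where B: "{x} \<subseteq> B" "B \<subseteq> W" "vec.independent B" "W \<subseteq> vec.span B"
    using vec.maximal_independent_subset_extend[of "{x}" W] by auto
  have "card B = 2" using vec.basis_card_eq_dim[OF B(2,4,3)] assms by simp
  then have "card (B - {x}) = 1" using B(1) by simp
  then obtain w0 where "B - {x} = {w0}" using card_1_singletonE by blast
  then have w0: "B = insert w0 {x}" "w0 \<notin> {x}" using B(1) by auto
  define w where "w = w0 - (w0 $ j / x $ j) *s x"
  have "w \<noteq> 0"
  proof
    assume "w = 0"
    then have "w0 = (w0 $ j / x $ j) *s x" by (simp add: w_def)
    then have "w0 \<in> vec.span {x}" by (metis vec.span_base vec.span_scale singletonI)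
    then show False using B(3) w0 by (simp add: vec.independent_insert)
  qed
  moreover have "w $ j = 0" using assms by (simp add: w_def)
  moreover have "\<exists>a b. v = a *s x + b *s w" if "v \<in> W" for v
  proof -
    have "v \<in> vec.span {w0, x}" using that B(4) w0 by auto
    then obtain b where "v - b *s w0 \<in> vec.span {x}" using vec.span_breakdown_eq by blast
    then obtain a where "v - b *s w0 = a *s x" by (auto simp: vec.span_singleton)
    then have "v = (a + b * (w0 $ j / x $ j)) *s x + b *s w"
      by (simp add: w_def vec_eq_iff algebra_simps)
    then show ?thesis by blast
  qed
  ultimately show ?thesis using that by blast
qed

section \<open>Holomorphic discs in a smooth curve\<close>

definition holomorphic_curve :: "(complex \<Rightarrow> complex ^ 'n) \<Rightarrow> complex set \<Rightarrow> bool"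
  where "holomorphic_curve \<phi> S \<longleftrightarrow> (\<forall>z\<in>S. \<exists>a. (\<phi> has_derivative (\<lambda>h. h *s a)) (at z))"

text \<open>Points of the cone that lie in \<open>\<Omega>\<close> come from the disc of half the radius, on which the constants in
  Harnack's inequality are bounded.\<close>

definition chart :: "(complex ^ 'n) set set \<Rightarrow> (complex \<Rightarrow> complex ^ 'n) \<Rightarrow> (complex ^ 'n) set \<Rightarrow> bool"
  where "chart C \<phi> \<Omega> \<longleftrightarrow> open \<Omega> \<and> holomorphic_curve \<phi> (ball 0 1) \<and> \<phi> ` ball 0 1 \<subseteq> affine_cone C \<and>
    (\<forall>v\<in>\<Omega> \<inter> affine_cone C. \<exists>z. norm z < 1/2 \<and> proj_point v = proj_point (\<phi> z))"

lemma tendsto_vector_scalar_mult: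
  fixes g :: "'b \<Rightarrow> complex ^ 'n"
  assumes "(f \<longlongrightarrow> c) F" "(g \<longlongrightarrow> v) F"
  shows "((\<lambda>x. f x *s g x) \<longlongrightarrow> c *s v) F"
  unfolding vector_scalar_mult_def by (intro tendsto_vec_lambda tendsto_mult tendsto_vec_nth assms)

text \<open>With \<open>P\<close> as in \<open>ideal_map_exists\<close> and \<open>A\<close> the linear map \<open>\<lambda>h. h - P' x h\<close> into the tangent space,
  the map \<open>G = A + P\<close> has the identity as its derivative at \<open>x\<close>, and on the cone over \<open>C\<close> it coincides
  with \<open>A\<close>. Hence its local inverse \<open>g\<close> maps a piece of the plane spanned by \<open>x\<close> and a second vector \<open>w\<close>
  onto a set that contains the cone near \<open>x\<close>, and up to scaling the line \<open>x + z *s w\<close> suffices. A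
  homogeneous polynomial that vanishes on \<open>C\<close> has zeros on the resulting disc that accumulate at the
  centre, since \<open>x\<close> is not isolated; so it vanishes on the disc, and the disc lies in \<open>C\<close>.\<close>

lemma chart_exists:
  fixes C :: "(complex ^ 'n) set set"
  assumes C: "proj_closed C" and x: "x \<in> affine_cone C" and dim: "vec.dim (cone_tangent C x) = 2"
    and nonisolated: "\<And>\<Omega>. open \<Omega> \<Longrightarrow> x \<in> \<Omega> \<Longrightarrow> \<exists>v\<in>\<Omega> \<inter> affine_cone C. proj_point v \<noteq> proj_point x"
    and \<epsilon>: "\<epsilon> > 0"
  obtains \<phi> \<Omega> where "chart C \<phi> \<Omega>" "x \<in> \<Omega>" "\<phi> ` ball 0 1 \<subseteq> ball x \<epsilon>"
proof -
  obtain F where F: "\<And>f. f \<in> F \<Longrightarrow> \<exists>k. homogeneous_poly k f" "C = proj_zeros F"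
    using C by (auto simp: proj_closed_def)
  obtain P P' where P: "ideal_map C P P'" and PW: "\<And>h. h - P' x h \<in> cone_tangent C x"
    using ideal_map_exists[OF x] by blast
  have x0: "x \<noteq> 0" using x by (simp add: affine_cone_def)
  then obtain j where j: "x $ j \<noteq> 0" by (auto simp: vec_eq_iff)
  obtain w :: "complex ^ 'n" where w: "w \<noteq> 0" "w $ j = 0"
    and span: "\<And>v. v \<in> cone_tangent C x \<Longrightarrow> \<exists>a b. v = a *s x + b *s w"
    using two_dim_basis[OF dim cone_tangent_self[OF x] j] by blast
  obtain k where k: "w $ k \<noteq> 0" using w by (auto simp: vec_eq_iff)
  have P_der: "(P has_derivative P' v) (at v)" and P_scale: "P' v (c *s h) = c *s P' v h" for v c h
    using P by (auto simp: ideal_map_def)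
  have P_bl: "bounded_linear (P' v)" for v using P_der has_derivative_bounded_linear by blast
  have P_zero: "P v = 0" if "v \<in> affine_cone C" for v using P that by (auto simp: ideal_map_def)
  define A where "A h = h - P' x h" for h
  have A_scale: "A (c *s h) = c *s A h" for c h by (simp add: A_def P_scale vec.scale_right_diff_distrib)
  have A_bl: "bounded_linear A" unfolding A_def by (intro bounded_linear_sub bounded_linear_ident P_bl)
  have A_cont: "isCont A v" for v using A_bl by (simp add: linear_continuous_at)
  \<comment> \<open>\<open>P\<close> vanishes on the line through \<open>x\<close>, so its derivative at \<open>x\<close> kills \<open>x\<close>.\<close>
  have A_x: "A x = x"
  proof -
    have "((\<lambda>t. x + t *s x) has_derivative (\<lambda>t. t *s x)) (at (0::complex))"
      by (auto intro!: derivative_eq_intros bounded_linear.has_derivative[OF bounded_linear_scale_vec])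
    then have "((\<lambda>t. P (x + t *s x)) has_derivative (\<lambda>t. P' x (t *s x))) (at (0::complex))"
      by (rule has_derivative_compose) (use P_der[of x] in simp)
    moreover have "((\<lambda>t. P (x + t *s x)) has_derivative (\<lambda>t. 0)) (at (0::complex))"
    proof (rule has_derivative_transform_within_open[of "\<lambda>_. 0" _ _ _ "ball 0 1"])
      fix t :: complex assume "t \<in> ball 0 1"
      then have "1 + t \<noteq> 0" by (metis add_eq_0_iff dist_0_norm less_irrefl mem_ball norm_minus_cancel norm_one)
      moreover have "x + t *s x = (1 + t) *s x" by (simp add: vec.scale_left_distrib)
      ultimately have "x + t *s x \<in> affine_cone C" using affine_cone_scale[OF x] by metis
      then show "0 = P (x + t *s x)" by (simp add: P_zero)
    qed auto
    ultimately have "(\<lambda>t::complex. P' x (t *s x)) = (\<lambda>t. 0)" by (rule has_derivative_unique)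
    then have "P' x (1 *s x) = 0" by meson
    then show ?thesis by (simp add: A_def)
  qed
  \<comment> \<open>The coordinates of \<open>A v\<close> with respect to \<open>x\<close> and \<open>w\<close>; the index \<open>k\<close> is one with \<open>w $ k \<noteq> 0\<close>.\<close>
  define a b where "a v = A v $ j / x $ j" and "b v = (A v $ k - a v * x $ k) / w $ k" for v
  have A_eq: "A v = a v *s x + b v *s w" for v
  proof -
    obtain a' b' where *: "A v = a' *s x + b' *s w" using span[OF PW[of v]] unfolding A_def by blast
    then have "a' = a v" using j w by (simp add: a_def)
    moreover then have "b' = b v" using k by (simp add: b_def *)
    ultimately show ?thesis using * by simp
  qed
  have a_cont: "isCont a v" and b_cont: "isCont b v" for v
    unfolding a_def b_def using j k A_cont by (auto intro!: continuous_intros)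
  have a_x: "a x = 1" and b_x: "b x = 0" using j k by (auto simp: a_def b_def A_x)
  define G where "G v = A v + P v" for v
  define G' where "G' v h = A h + P' v h" for v h
  have G_der: "(G has_derivative G' v) (at v)" for v
    unfolding G_def G'_def by (intro has_derivative_add P_der bounded_linear_imp_has_derivative A_bl)
  have G_bl: "bounded_linear (G' v)" for v using G_der has_derivative_bounded_linear by blast
  have G_scale: "G' v (c *s h) = c *s G' v h" for v c h
    by (simp add: G'_def A_scale P_scale vec.scale_right_distrib)
  have G_apply: "blinfun_apply (Blinfun (G' v)) = G' v" for v
    by (rule bounded_linear_Blinfun_apply[OF G_bl])
  have "continuous_on UNIV (\<lambda>v. Blinfun (G' v))"
    by (rule continuous_on_blinfun_componentwise)
      (use P in \<open>auto simp: G_apply G'_def ideal_map_def intro!: continuous_intros\<close>)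
  moreover have "id_blinfun o\<^sub>L Blinfun (G' x) = id_blinfun"
    by (rule blinfun_eqI) (simp add: G_apply G'_def A_def)
  ultimately obtain U V g g' where U: "open U" "x \<in> U" "open V" "G x \<in> V" "homeomorphism U V G g"
    and g_der: "\<And>y. y \<in> V \<Longrightarrow> (g has_derivative g' y) (at y)"
    and g_inv: "\<And>y. y \<in> V \<Longrightarrow> g' y = inv (G' (g y))"
    and bij: "\<And>y. y \<in> V \<Longrightarrow> bij (G' (g y))"
    using inverse_function_theorem[of UNIV G "\<lambda>v. Blinfun (G' v)" x id_blinfun] G_der
    unfolding G_apply by (metis open_UNIV UNIV_I)
  have G_x: "G x = x" by (simp add: G_def A_x P_zero[OF x])
  have gG: "g (G v) = v" if "v \<in> U" for v using U(5) that by (simp add: homeomorphism_def)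
  have g_scale: "g' y (c *s h) = c *s g' y h" if y: "y \<in> V" for y c h
  proof -
    have "G' (g y) (c *s g' y h) = c *s h"
      unfolding G_scale g_inv[OF y] by (simp add: bij_is_surj[OF bij[OF y]] surj_f_inv_f)
    then show ?thesis
      unfolding g_inv[OF y] by (metis bij[OF y] bij_is_inj inv_f_f)
  qed
  define \<phi>0 where "\<phi>0 = (\<lambda>z. g (x + z *s w))"
  have line_der: "((\<lambda>z. x + z *s w) has_derivative (\<lambda>h. h *s w)) (at z)" for z
    by (auto intro!: derivative_eq_intros bounded_linear.has_derivative[OF bounded_linear_scale_vec])
  have \<phi>0_der: "(\<phi>0 has_derivative (\<lambda>h. h *s g' (x + z *s w) w)) (at z)" if "x + z *s w \<in> V" for z
    using has_derivative_compose[OF line_der g_der[OF that]] g_scale[OF that] by (simp add: \<phi>0_def)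
  have xV: "x + 0 *s w \<in> V" using U G_x by simp
  have \<phi>0_0: "\<phi>0 0 = x" using gG[OF U(2)] G_x by (simp add: \<phi>0_def)
  have "isCont (\<lambda>z. x + z *s w) 0" by (rule has_derivative_continuous[OF line_der])
  moreover have "isCont \<phi>0 0" by (rule has_derivative_continuous[OF \<phi>0_der[OF xV]])
  ultimately have "\<forall>\<^sub>F z in at 0. x + z *s w \<in> V \<and> \<phi>0 z \<in> ball x (min \<epsilon> (norm x))"
    using U(3) xV \<phi>0_0 \<epsilon> x0
    by (intro eventually_conj topological_tendstoD[of _ "x + 0 *s w"] topological_tendstoD[of \<phi>0 "\<phi>0 0"])
      (auto simp: isCont_def)
  then obtain \<rho> where \<rho>: "\<rho> > 0" and \<rho>': "\<And>z. z \<noteq> 0 \<Longrightarrow> dist z 0 < \<rho> \<Longrightarrow>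
      x + z *s w \<in> V \<and> \<phi>0 z \<in> ball x (min \<epsilon> (norm x))"
    unfolding eventually_at by auto
  have near: "x + z *s w \<in> V" "\<phi>0 z \<in> ball x (min \<epsilon> (norm x))" if "norm z < \<rho>" for z
    using \<rho>'[of z] that xV \<phi>0_0 \<epsilon> x0 by (cases "z = 0"; simp)+
  define \<phi> where "\<phi> = (\<lambda>z. \<phi>0 (of_real \<rho> * z))"
  have in_\<rho>: "norm (of_real \<rho> * z) < \<rho>" if "norm z < 1" for z :: complex
    using that \<rho> by (simp add: norm_mult)
  have \<phi>_nz: "\<phi> z \<noteq> 0" if "norm z < 1" for z
    using near(2)[OF in_\<rho>[OF that]] by (auto simp: \<phi>_def)
  have \<phi>_der: "\<exists>a. (\<phi> has_derivative (\<lambda>h. h *s a)) (at z)" if "norm z < 1" for z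
  proof (intro exI)
    have "((\<lambda>z::complex. of_real \<rho> * z) has_derivative (\<lambda>h. of_real \<rho> * h)) (at z)"
      by (auto intro!: derivative_eq_intros)
    from has_derivative_compose[OF this \<phi>0_der[OF near(1)[OF in_\<rho>[OF that]]]]
    show "(\<phi> has_derivative (\<lambda>h. h *s (of_real \<rho> *s g' (x + (of_real \<rho> * z) *s w) w))) (at z)"
      by (simp add: \<phi>_def mult.commute)
  qed
  then have hol: "holomorphic_curve \<phi> (ball 0 1)" unfolding holomorphic_curve_def by simp
  have a_lim: "(a \<longlongrightarrow> 1) (nhds x)" and b_lim: "(b \<longlongrightarrow> 0) (nhds x)"
    using a_cont[of x, unfolded isCont_def tendsto_at_iff_tendsto_nhds]
      b_cont[of x, unfolded isCont_def tendsto_at_iff_tendsto_nhds] by (simp_all only: a_x b_x)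
  have "((\<lambda>v. (1 / a v) *s v) \<longlongrightarrow> (1 / 1) *s x) (nhds x)"
    by (intro tendsto_vector_scalar_mult tendsto_divide a_lim tendsto_ident_at tendsto_const filterlim_ident) auto
  then have U_lim: "((\<lambda>v. (1 / a v) *s v) \<longlongrightarrow> x) (nhds x)" by simp
  have "((\<lambda>v. b v / (a v * of_real \<rho>)) \<longlongrightarrow> 0 / (1 * of_real \<rho>)) (nhds x)"
    by (intro tendsto_intros a_lim b_lim) (use \<rho> in auto)
  then have z_lim: "((\<lambda>v. b v / (a v * of_real \<rho>)) \<longlongrightarrow> 0) (nhds x)" by simp
  have ev: "\<forall>\<^sub>F v in nhds x. a v \<noteq> 0 \<and> (1 / a v) *s v \<in> U \<and> b v / (a v * of_real \<rho>) \<in> ball 0 \<delta>"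
    if "\<delta> > 0" for \<delta>
    by (intro eventually_conj tendsto_imp_eventually_ne[OF a_lim] topological_tendstoD[OF U_lim]
        topological_tendstoD[OF z_lim] U open_ball) (use that in auto)
  have param: "proj_point v = proj_point (\<phi> (b v / (a v * of_real \<rho>)))"
    if "a v \<noteq> 0" "(1 / a v) *s v \<in> U" "v \<in> affine_cone C" for v
  proof -
    let ?v = "(1 / a v) *s v"
    have "?v \<in> affine_cone C" by (rule affine_cone_scale) (use that in auto)
    then have "G ?v = (1 / a v) *s A v" by (simp add: G_def P_zero A_scale)
    also have "\<dots> = x + (b v / a v) *s w" using that(1) by (simp add: A_eq vec_eq_iff field_simps)
    finally have "?v = \<phi>0 (b v / a v)" using gG[OF that(2)] by (simp add: \<phi>0_def)
    also have "\<dots> = \<phi> (b v / (a v * of_real \<rho>))" using \<rho> by (simp add: \<phi>_def)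
    finally show ?thesis using proj_point_scale[of "1 / a v" v] that(1) by simp
  qed
  have \<phi>_C: "\<phi> z \<in> affine_cone C" if z: "norm z < 1" for z
  proof -
    \<comment> \<open>This is the identity theorem; the zeros are the parameters of points of \<open>C\<close> near \<open>x\<close>.\<close>
    have "f (\<phi> z) = 0" if "f \<in> F" for f
    proof (rule analytic_continuation[of "\<lambda>z. f (\<phi> z)" "ball 0 1" "{z. norm z < 1 \<and> f (\<phi> z) = 0}" 0 z])
      obtain d f' where "homogeneous_poly d f" and f': "entire_with f f'"
        using F(1)[OF \<open>f \<in> F\<close>] homogeneous_poly_entire by blast
      show "(\<lambda>z. f (\<phi> z)) holomorphic_on ball 0 1"
      proof (rule holomorphic_onI)
        fix u :: complex assume "u \<in> ball 0 1"
        then obtain c where "(\<phi> has_derivative (\<lambda>h. h *s c)) (at u)"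
          using \<phi>_der[of u] by auto
        from has_derivative_compose[OF this, of f "f' (\<phi> u)"]
        have "((\<lambda>z. f (\<phi> z)) has_derivative (\<lambda>h. h * f' (\<phi> u) c)) (at u)"
          using f' by (simp add: entire_with_def)
        then have "((\<lambda>z. f (\<phi> z)) has_field_derivative f' (\<phi> u) c) (at u)"
          by (simp add: has_field_derivative_def mult_commute_abs)
        then show "(\<lambda>z. f (\<phi> z)) field_differentiable at u within ball 0 1"
          using field_differentiable_at_within field_differentiable_def by blast
      qed
      show "0 islimpt {z. norm z < 1 \<and> f (\<phi> z) = 0}"
        unfolding islimpt_approachable
      proof (intro allI impI)
        fix \<delta> :: real assume "\<delta> > 0"
        then have "\<forall>\<^sub>F v in nhds x. a v \<noteq> 0 \<and> (1 / a v) *s v \<in> U \<and>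
            b v / (a v * of_real \<rho>) \<in> ball 0 (min 1 \<delta>)" by (intro ev) simp
        then obtain S where S: "open S" "x \<in> S" "\<And>v. v \<in> S \<Longrightarrow> a v \<noteq> 0 \<and> (1 / a v) *s v \<in> U \<and>
            b v / (a v * of_real \<rho>) \<in> ball 0 (min 1 \<delta>)" unfolding eventually_nhds by blast
        from nonisolated[OF S(1,2)] obtain v where v: "v \<in> S" "v \<in> affine_cone C" "proj_point v \<noteq> proj_point x"
          by blast
        let ?z = "b v / (a v * of_real \<rho>)"
        have v': "proj_point v = proj_point (\<phi> ?z)" "norm ?z < 1" "norm ?z < \<delta>"
          using param S(3)[OF v(1)] v(2) by (simp_all add: dist_norm)
        have "\<phi> 0 = x" by (simp add: \<phi>_def \<phi>0_0)
        then have "?z \<noteq> 0" using v' v(3) by metis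
        moreover have "proj_point (\<phi> ?z) \<in> proj_zeros F"
          using v v' F(2) by (simp add: affine_cone_def)
        then have "f (\<phi> ?z) = 0" using mem_proj_zeros[OF F(1) \<phi>_nz[OF v'(2)]] \<open>f \<in> F\<close> by blast
        ultimately show "\<exists>z\<in>{z. norm z < 1 \<and> f (\<phi> z) = 0}. z \<noteq> 0 \<and> dist z 0 < \<delta>"
          using v' by (intro bexI[of _ ?z]) (auto simp: dist_norm)
      qed
    qed (use z in auto)
    then show ?thesis
      using mem_proj_zeros[OF F(1) \<phi>_nz[OF z]] \<phi>_nz[OF z] F(2) by (simp add: affine_cone_def)
  qed
  from ev[of "1/2"] obtain \<Omega> where \<Omega>: "open \<Omega>" "x \<in> \<Omega>" "\<And>v. v \<in> \<Omega> \<Longrightarrow> a v \<noteq> 0 \<and> (1 / a v) *s v \<in> U \<and>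
            b v / (a v * of_real \<rho>) \<in> ball 0 (1/2)" unfolding eventually_nhds by auto
  have "\<exists>z. norm z < 1/2 \<and> proj_point v = proj_point (\<phi> z)" if "v \<in> \<Omega> \<inter> affine_cone C" for v
    using param \<Omega>(3) that by (intro exI[of _ "b v / (a v * of_real \<rho>)"]) (auto simp: dist_norm)
  then have "chart C \<phi> \<Omega>" unfolding chart_def using \<Omega>(1) hol \<phi>_C by auto
  moreover have "\<phi> ` ball 0 1 \<subseteq> ball x \<epsilon>"
    using near(2)[OF in_\<rho>] by (auto simp: \<phi>_def)
  ultimately show ?thesis using that \<Omega> by blast
qed

section \<open>The topology of projective space\<close>

lemma topspace_quotient_topology: "topspace (quotient_topology T q) = q ` topspace T"
  by (rule quotient_imp_surjective_map[OF quotient_map_quotient_topology, symmetric])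

lemma topspace_proj_topology: "topspace proj_topology = proj_space"
  by (simp add: proj_topology_def topspace_quotient_topology proj_space_def)

lemma continuous_map_proj_point: "continuous_map (top_of_set (- {0})) proj_topology proj_point"
  unfolding proj_topology_def by (rule quotient_imp_continuous_map[OF quotient_map_quotient_topology])

lemma continuous_scale_vec: "continuous_on UNIV (\<lambda>v. c *s (v :: complex ^ 'n))"
  unfolding vector_scalar_mult_def by (intro continuous_intros)

text \<open>The preimage of the image is the union of the multiples of \<open>\<Omega>\<close> by nonzero scalars.\<close>

lemma openin_proj_image:
  assumes "open \<Omega>"
  shows "openin proj_topology (proj_point ` (\<Omega> - {0}))"
proof -
  let ?S = "{v \<in> topspace (top_of_set (- {0})). proj_point v \<in> proj_point ` (\<Omega> - {0})}"
  have "?S = (\<Union>c\<in>- {0}. (\<lambda>v. c *s v) -` \<Omega>) \<inter> - {0}"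
  proof (intro set_eqI iffI)
    fix v assume v: "v \<in> ?S"
    then obtain u where u: "u \<in> \<Omega>" "u \<noteq> 0" "proj_point u = proj_point v" by auto
    obtain c where c: "c \<noteq> 0" "u = c *s v" using proj_point_eqD[OF u(3,2)] .
    have "c *s v \<in> \<Omega>" "v \<noteq> 0" using c u(1) v by auto
    then show "v \<in> (\<Union>c\<in>- {0}. (\<lambda>v. c *s v) -` \<Omega>) \<inter> - {0}" using c(1) by blast
  next
    fix v assume "v \<in> (\<Union>c\<in>- {0}. (\<lambda>v. c *s v) -` \<Omega>) \<inter> - {0}"
    then obtain c where c: "c \<noteq> 0" "c *s v \<in> \<Omega>" "v \<noteq> 0" by auto
    have "proj_point v = proj_point (c *s v)" using proj_point_scale[OF c(1)] by (rule sym)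
    moreover have "c *s v \<in> \<Omega> - {0}" using c by simp
    ultimately have "proj_point v \<in> proj_point ` (\<Omega> - {0})" by blast
    then show "v \<in> ?S" using c(3) by simp
  qed
  moreover have "open ((\<Union>c\<in>- {0}. (\<lambda>v. c *s v) -` \<Omega>) \<inter> - {0})"
    by (intro open_Int open_UN ballI open_vimage assms continuous_scale_vec) auto
  ultimately have "open ?S" by simp
  then have "openin (top_of_set (- {0})) ?S" by (intro open_openin_trans) auto
  then show ?thesis unfolding proj_topology_def openin_quotient_topology by (simp add: image_mono Diff_subset_conv Compl_eq_Diff_UNIV Diff_mono)
qed

lemma proj_point_in_space: "v \<noteq> 0 \<Longrightarrow> proj_point v \<in> proj_space"
  by (simp add: proj_space_def)

lemma closed_proj_point: "closed (proj_point x)"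
proof -
  have "subspace (proj_point x)"
  proof (intro subspaceI)
    show "c *\<^sub>R u \<in> proj_point x" if u: "u \<in> proj_point x" for c u
    proof -
      obtain d where "u = d *s x" using u by (auto simp: mem_proj_point)
      then have "c *\<^sub>R u = (of_real c * d) *s x"
        by (simp add: vec_eq_iff scaleR_conv_of_real[where 'a = complex] mult.assoc)
      then show ?thesis by (auto simp: mem_proj_point)
    qed
    show "0 \<in> proj_point x" by (simp add: proj_point_def vec.span_zero)
    show "u + v \<in> proj_point x" if "u \<in> proj_point x" "v \<in> proj_point x" for u v
      using that by (simp add: proj_point_def vec.span_add)
  qed
  then show ?thesis by (rule closed_subspace)
qed

lemma closedin_proj_singleton:
  assumes "x \<noteq> 0"
  shows "closedin proj_topology {proj_point x}"
  unfolding closedin_def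
proof
  show "{proj_point x} \<subseteq> topspace proj_topology"
    using assms by (simp add: topspace_proj_topology proj_point_in_space)
  have "topspace proj_topology - {proj_point x} = proj_point ` (- proj_point x - {0})"
  proof (intro set_eqI iffI)
    fix L assume "L \<in> topspace proj_topology - {proj_point x}"
    then obtain v where v: "L = proj_point v" "v \<noteq> 0" "proj_point v \<noteq> proj_point x"
      by (auto simp: topspace_proj_topology proj_space_def)
    have "v \<notin> proj_point x"
    proof
      assume "v \<in> proj_point x"
      then obtain c where c: "v = c *s x" by (auto simp: mem_proj_point)
      then have "c \<noteq> 0" using v by auto
      then show False using v c proj_point_scale[OF \<open>c \<noteq> 0\<close>, of x] by simp
    qed
    then show "L \<in> proj_point ` (- proj_point x - {0})" using v(1,2) by blast
  next
    fix L assume "L \<in> proj_point ` (- proj_point x - {0})"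
    then obtain v where v: "L = proj_point v" "v \<noteq> 0" "v \<notin> proj_point x" by auto
    then have "proj_point v \<noteq> proj_point x" using proj_point_self by blast
    then show "L \<in> topspace proj_topology - {proj_point x}"
      using v by (simp add: topspace_proj_topology proj_point_in_space)
  qed
  moreover have "open (- proj_point x)" by (intro open_Compl closed_proj_point)
  ultimately show "openin proj_topology (topspace proj_topology - {proj_point x})"
    using openin_proj_image[of "- proj_point x"] by simp
qed

lemma proj_closed_subset: "proj_closed C \<Longrightarrow> C \<subseteq> proj_space"
  by (auto simp: proj_closed_def proj_zeros_def)

lemma point_of_curve:
  assumes "C \<subseteq> proj_space" "L \<in> C"
  obtains v where "v \<in> affine_cone C" "L = proj_point v"
proof -
  obtain v where "v \<noteq> 0" "L = proj_point v" using assms by (auto simp: proj_space_def)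
  then show ?thesis using that[of v] assms(2) by (simp add: affine_cone_def)
qed

lemma openin_curve_image:
  assumes "C \<subseteq> proj_space" "open \<Omega>"
  shows "openin (subtopology proj_topology C) (proj_point ` (\<Omega> \<inter> affine_cone C))"
proof -
  have "proj_point ` (\<Omega> \<inter> affine_cone C) = proj_point ` (\<Omega> - {0}) \<inter> C"
    by (auto simp: affine_cone_def)
  then show ?thesis using openin_proj_image[OF assms(2)] unfolding openin_subtopology by blast
qed

text \<open>An isolated point of \<open>C\<close> would be open, and it is closed anyway.\<close>

lemma connected_nonisolated:
  assumes C: "C \<subseteq> proj_space" and conn: "connected_space (subtopology proj_topology C)"
    and x: "x \<in> affine_cone C" and two: "\<not> C \<subseteq> {proj_point x}" and \<Omega>: "open \<Omega>" "x \<in> \<Omega>"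
  shows "\<exists>v\<in>\<Omega> \<inter> affine_cone C. proj_point v \<noteq> proj_point x"
proof (rule ccontr)
  assume "\<not> ?thesis"
  then have "proj_point ` (\<Omega> \<inter> affine_cone C) = {proj_point x}" using x \<Omega> by blast
  then have "openin (subtopology proj_topology C) {proj_point x}"
    using openin_curve_image[OF C \<Omega>(1)] by metis
  moreover have "closedin (subtopology proj_topology C) {proj_point x}"
  proof -
    have "{proj_point x} = {proj_point x} \<inter> C" "closedin proj_topology {proj_point x}"
      using x closedin_proj_singleton by (auto simp: affine_cone_def)
    then show ?thesis unfolding closedin_subtopology by blast
  qed
  moreover have "topspace (subtopology proj_topology C) = C"
    using C by (simp add: topspace_proj_topology Int_absorb1)
  ultimately show False using conn two unfolding connected_space_clopen_in by blast
qed

text \<open>A chain of two irreducible sets does not fit into a single point.\<close>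

lemma two_points:
  assumes "proj_dim C = 1"
  shows "\<not> C \<subseteq> {L}"
proof
  assume C: "C \<subseteq> {L}"
  have "k = 0" if Z: "\<forall>i\<le>k. proj_irreducible (Z i) \<and> Z i \<subseteq> C" "\<forall>i<k. Z i \<subset> Z (Suc i)" for k Z
  proof (rule ccontr)
    assume "k \<noteq> 0"
    then have "Z 0 \<noteq> {}" "Z 0 \<subset> Z 1" "Z 1 \<subseteq> C"
      using Z(1)[rule_format, of 0] Z(1)[rule_format, of 1] Z(2)[rule_format, of 0]
      by (simp_all add: proj_irreducible_def)
    then show False using C by blast
  qed
  then have "proj_dim C \<le> 0" unfolding proj_dim_def by (intro Sup_least) (auto simp: zero_enat_def)
  then show False using assms by simp
qed

section \<open>The topology of symmetric powers\<close>

definition tuples :: "(complex ^ 'n) set set \<Rightarrow> ('d::finite \<Rightarrow> (complex ^ 'n) set) set"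
  where "tuples C = {y. \<forall>i. y i \<in> C}"

definition tuple_topology :: "(complex ^ 'n) set set \<Rightarrow> ('d::finite \<Rightarrow> (complex ^ 'n) set) topology"
  where "tuple_topology C = subtopology (product_topology (\<lambda>_. proj_topology) UNIV) (tuples C)"

lemma topol_cartesian_power: "topol (cartesian_power C) = tuple_topology C"
  by (simp add: cartesian_power_def hol_subspace_def multiproj_space_def tuple_topology_def tuples_def)

lemma topol_sym_power: "topol (sym_power C) = quotient_topology (tuple_topology C) sym_orbit"
  by (simp add: sym_power_def hol_quotient_def topol_cartesian_power)

lemma topspace_tuple_topology: "C \<subseteq> proj_space \<Longrightarrow> topspace (tuple_topology C) = tuples C"
  by (simp add: tuple_topology_def tuples_def topspace_proj_topology Int_absorb1 Collect_mono_iff subset_iff PiE_def)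

lemma topspace_sym_power: "C \<subseteq> proj_space \<Longrightarrow> topspace (topol (sym_power C)) = sym_orbit ` tuples C"
  by (simp add: topol_sym_power topspace_quotient_topology topspace_tuple_topology)

lemma sym_orbit_permute:
  assumes "s permutes UNIV"
  shows "sym_orbit (y \<circ> s) = sym_orbit y"
proof
  show "sym_orbit (y \<circ> s) \<subseteq> sym_orbit y"
  proof
    fix u assume "u \<in> sym_orbit (y \<circ> s)"
    then obtain r where r: "u = (y \<circ> s) \<circ> r" "r permutes UNIV" by (auto simp: sym_orbit_def)
    then have "u = y \<circ> (s \<circ> r)" by (simp add: comp_assoc)
    then show "u \<in> sym_orbit y" using permutes_compose[OF r(2) assms] by (auto simp: sym_orbit_def)
  qed
  show "sym_orbit y \<subseteq> sym_orbit (y \<circ> s)"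
  proof
    fix u assume "u \<in> sym_orbit y"
    then obtain r where r: "u = y \<circ> r" "r permutes UNIV" by (auto simp: sym_orbit_def)
    have "u = (y \<circ> s) \<circ> (inv s \<circ> r)"
      using permutes_inv_o(1)[OF assms] r(1) by (metis comp_assoc comp_id)
    moreover have "inv s \<circ> r permutes UNIV"
      using r(2) permutes_inv[OF assms] permutes_compose by blast
    ultimately show "u \<in> sym_orbit (y \<circ> s)" by (auto simp: sym_orbit_def)
  qed
qed

lemma sym_orbit_eqD:
  assumes "sym_orbit y = sym_orbit y'"
  obtains s where "s permutes UNIV" "y = y' \<circ> s"
proof -
  have "y \<circ> id \<in> sym_orbit y" unfolding sym_orbit_def using permutes_id by blast
  then have "y \<in> sym_orbit y" by simp
  then show ?thesis using that assms by (auto simp: sym_orbit_def)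
qed

text \<open>The preimage of the image is the union of the finitely many translates by permutations.\<close>

lemma openin_sym_image:
  assumes C: "C \<subseteq> proj_space" and O: "openin (tuple_topology C) O'"
  shows "openin (topol (sym_power C)) (sym_orbit ` O')"
proof -
  have sub: "O' \<subseteq> topspace (tuple_topology C)" by (rule openin_subset[OF O])
  let ?pre = "\<lambda>s. {y \<in> topspace (tuple_topology C). y \<circ> s \<in> O'}"
  have "openin (tuple_topology C) (?pre s)" for s :: "'b \<Rightarrow> 'b"
  proof (rule openin_continuous_map_preimage[OF _ O])
    have *: "continuous_map (product_topology (\<lambda>_. proj_topology) UNIV) (product_topology (\<lambda>_. proj_topology) UNIV)
        (\<lambda>y. y \<circ> s)"
      unfolding continuous_map_componentwise_UNIV o_def by (intro allI continuous_map_product_projection) simp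
    show "continuous_map (tuple_topology C) (tuple_topology C) (\<lambda>y. y \<circ> s)"
      unfolding tuple_topology_def continuous_map_in_subtopology
      by (rule conjI[OF continuous_map_from_subtopology[OF *]]) (simp add: tuples_def image_subset_iff)
  qed
  then have "openin (tuple_topology C) (\<Union>s\<in>{s. s permutes UNIV}. ?pre s)" by (intro openin_Union) auto
  moreover have "{y \<in> topspace (tuple_topology C). sym_orbit y \<in> sym_orbit ` O'} = (\<Union>s\<in>{s. s permutes UNIV}. ?pre s)"
  proof (intro set_eqI iffI)
    fix y assume "y \<in> {y \<in> topspace (tuple_topology C). sym_orbit y \<in> sym_orbit ` O'}"
    then obtain u where u: "y \<in> topspace (tuple_topology C)" "u \<in> O'" "sym_orbit u = sym_orbit y" by auto
    then obtain s where "s permutes UNIV" "u = y \<circ> s" using sym_orbit_eqD by blast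
    then show "y \<in> (\<Union>s\<in>{s. s permutes UNIV}. ?pre s)" using u by auto
  next
    fix y assume "y \<in> (\<Union>s\<in>{s. s permutes UNIV}. ?pre s)"
    then obtain s where "s permutes UNIV" "y \<in> topspace (tuple_topology C)" "y \<circ> s \<in> O'" by auto
    then show "y \<in> {y \<in> topspace (tuple_topology C). sym_orbit y \<in> sym_orbit ` O'}"
      using sym_orbit_permute by (metis (mono_tags, lifting) imageI mem_Collect_eq)
  qed
  ultimately show ?thesis
    unfolding topol_sym_power openin_quotient_topology using sub by (simp add: image_mono)
qed

lemma continuous_map_tuple_nth:
  "continuous_map (tuple_topology C) (subtopology proj_topology C) (\<lambda>y. y i)"
  unfolding tuple_topology_def continuous_map_in_subtopology
proof
  show "continuous_map (subtopology (product_topology (\<lambda>_. proj_topology) UNIV) (tuples C)) proj_topology (\<lambda>y. y i)"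
    by (rule continuous_map_from_subtopology[OF continuous_map_product_projection]) simp
qed (simp add: tuples_def)

text \<open>If \<open>U\<close> is open and closed in \<open>C\<close>, the divisors supported in \<open>U\<close> form an open and closed set: it and
  its complement are images of open sets of tuples that are invariant under permutations.\<close>

lemma connected_curve:
  fixes C :: "(complex ^ 'n) set set"
  assumes C: "C \<subseteq> proj_space"
    and conn: "connected_space (topol (sym_power C :: ('d::finite \<Rightarrow> (complex ^ 'n) set) set holspace))"
  shows "connected_space (subtopology proj_topology C)"
  unfolding connected_space_clopen_in
proof (intro allI impI)
  fix U assume U: "openin (subtopology proj_topology C) U \<and> closedin (subtopology proj_topology C) U"
  let ?T = "tuple_topology C :: ('d \<Rightarrow> (complex ^ 'n) set) topology"
  have top: "topspace (subtopology proj_topology C) = C" using C by (auto simp: topspace_proj_topology)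
  have U_sub: "U \<subseteq> C" and U': "openin (subtopology proj_topology C) (C - U)"
    using U top openin_subset by (auto simp: closedin_def)
  have tT: "topspace ?T = tuples C" by (rule topspace_tuple_topology[OF C])
  let ?A = "{y \<in> tuples C. \<forall>i::'d. y i \<in> U}" and ?B = "{y \<in> tuples C. \<exists>i::'d. y i \<in> C - U}"
  have "openin ?T (\<Inter>i\<in>UNIV. {y \<in> topspace ?T. y i \<in> U})"
    using U by (intro openin_INT2 finite openin_continuous_map_preimage[OF continuous_map_tuple_nth]) auto
  moreover have "?A = (\<Inter>i\<in>UNIV. {y \<in> topspace ?T. y i \<in> U})" unfolding tT by auto
  ultimately have A: "openin (topol (sym_power C)) (sym_orbit ` ?A)"
    using openin_sym_image[OF C] by simp
  have "openin ?T (\<Union>i\<in>UNIV. {y \<in> topspace ?T. y i \<in> C - U})"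
    by (rule openin_Union) (use openin_continuous_map_preimage[OF continuous_map_tuple_nth U'] in auto)
  moreover have "?B = (\<Union>i\<in>UNIV. {y \<in> topspace ?T. y i \<in> C - U})" unfolding tT by auto
  ultimately have B: "openin (topol (sym_power C)) (sym_orbit ` ?B)"
    using openin_sym_image[OF C] by simp
  have disj: "sym_orbit ` ?A \<inter> sym_orbit ` ?B = {}"
  proof (rule ccontr)
    assume "\<not> ?thesis"
    then obtain y u where yu: "y \<in> ?A" "u \<in> ?B" "sym_orbit u = sym_orbit y" by auto
    then obtain s where "u = y \<circ> s" using sym_orbit_eqD by blast
    then show False using yu by auto
  qed
  have un: "topspace (topol (sym_power C)) \<subseteq> sym_orbit ` ?A \<union> sym_orbit ` ?B"
    unfolding topspace_sym_power[OF C] by (auto simp: tuples_def)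
  have "sym_orbit ` ?A = {} \<or> sym_orbit ` ?B = {}"
    using conn A B disj un unfolding connected_space_def by blast
  moreover have "(\<lambda>_. L) \<in> ?A" if "L \<in> U" for L using that U_sub by (auto simp: tuples_def)
  moreover have "(\<lambda>_. L) \<in> ?B" if "L \<in> C - U" for L using that by (auto simp: tuples_def)
  ultimately show "U = {} \<or> U = topspace (subtopology proj_topology C)"
    unfolding top using U_sub by blast
qed

text \<open>The quotient map in homogeneous coordinates. They bring \<open>C\<^sub>d\<close> within reach of metric notions, here
  compactness and the distance of vectors.\<close>

definition vec_orbit :: "complex ^ 'n ^ 'd \<Rightarrow> ('d::finite \<Rightarrow> (complex ^ 'n) set) set"
  where "vec_orbit v = sym_orbit (\<lambda>i. proj_point (v $ i))"

lemma continuous_map_vec_tuple: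
  "continuous_map (top_of_set {v. \<forall>i. v $ i \<in> affine_cone C}) (tuple_topology C) (\<lambda>v i. proj_point (v $ i))"
proof -
  have "continuous_map (top_of_set {v. \<forall>i. v $ i \<in> affine_cone C}) proj_topology (\<lambda>v. proj_point (v $ i))" for i
  proof (rule continuous_map_compose[OF _ continuous_map_proj_point, unfolded o_def])
    show "continuous_map (top_of_set {v. \<forall>i. v $ i \<in> affine_cone C}) (top_of_set (- {0})) (\<lambda>v. v $ i)"
      by (simp add: affine_cone_def continuous_on_component image_subset_iff)
  qed
  then show ?thesis
    unfolding tuple_topology_def continuous_map_in_subtopology continuous_map_componentwise_UNIV
    by (intro conjI allI) (simp_all add: tuples_def affine_cone_def image_subset_iff)
qed

lemma continuous_map_vec_orbit:
  "continuous_map (top_of_set {v. \<forall>i. v $ i \<in> affine_cone C}) (topol (sym_power C)) vec_orbit"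
  unfolding vec_orbit_def[abs_def] topol_sym_power
  by (rule continuous_map_compose[OF continuous_map_vec_tuple
        quotient_imp_continuous_map[OF quotient_map_quotient_topology], unfolded o_def])

lemma compact_unit_cone:
  fixes C :: "(complex ^ 'n) set set"
  assumes "proj_closed C"
  shows "compact {v \<in> affine_cone C. norm v = 1}"
proof -
  obtain F where F: "\<And>f. f \<in> F \<Longrightarrow> \<exists>k. homogeneous_poly k f" "C = proj_zeros F"
    using assms by (auto simp: proj_closed_def)
  have "{v \<in> affine_cone C. norm v = 1} = sphere 0 1 \<inter> (\<Inter>f\<in>F. f -` {0})"
  proof (intro set_eqI)
    fix v :: "complex ^ 'n"
    show "v \<in> {v \<in> affine_cone C. norm v = 1} \<longleftrightarrow> v \<in> sphere 0 1 \<inter> (\<Inter>f\<in>F. f -` {0})"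
      using mem_proj_zeros[OF F(1), where v = v] by (cases "v = 0") (auto simp: affine_cone_def F(2))
  qed
  moreover have "closed (f -` {0})" if f: "f \<in> F" for f
  proof -
    obtain k f' where "homogeneous_poly k f" "entire_with f f'" using F(1)[OF f] homogeneous_poly_entire by blast
    then show ?thesis by (intro closed_vimage entire_with_continuous) auto
  qed
  ultimately show ?thesis by (metis (no_types, lifting) closed_INT compact_Int_closed compact_sphere)
qed

lemma compact_vec:
  fixes K :: "'a::euclidean_space set"
  assumes "compact K"
  shows "compact {v :: 'a ^ 'd. \<forall>i. v $ i \<in> K}"
proof (rule compact_eq_bounded_closed[THEN iffD2], rule conjI)
  obtain B where B: "\<And>x. x \<in> K \<Longrightarrow> norm x \<le> B" using assms compact_imp_bounded bounded_iff by metis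
  have "norm v \<le> real CARD('d) * B" if "\<forall>i. v $ i \<in> K" for v :: "'a ^ 'd"
  proof -
    have "norm v \<le> (\<Sum>i\<in>UNIV. norm (v $ i))" by (simp add: norm_vec_def L2_set_le_sum)
    also have "\<dots> \<le> real CARD('d) * B" by (rule sum_bounded_above) (use B that in auto)
    finally show ?thesis .
  qed
  then show "bounded {v :: 'a ^ 'd. \<forall>i. v $ i \<in> K}" by (auto simp: bounded_iff)
  have "{v :: 'a ^ 'd. \<forall>i. v $ i \<in> K} = (\<Inter>i. (\<lambda>v. v $ i) -` K)" by auto
  moreover have "closed ((\<lambda>v :: 'a ^ 'd. v $ i) -` K)" for i
    by (intro closed_vimage compact_imp_closed[OF assms] continuous_intros)
  ultimately show "closed {v :: 'a ^ 'd. \<forall>i. v $ i \<in> K}" by auto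
qed

section \<open>Coverings of symmetric powers\<close>

text \<open>Unfolding the structure sheaves of the covering, of the quotient and of the power of \<open>C\<close>, the
  function \<open>f \<circ> s\<close> is locally the composition of a holomorphic function of the homogeneous coordinates
  with \<open>v\<close>, and the chain rule applies.\<close>

lemma hol_lift_holomorphic:
  fixes C :: "(complex ^ 'n) set set" and v :: "complex \<Rightarrow> complex ^ 'n ^ 'd::finite"
  assumes C: "C \<subseteq> proj_space"
    and cov: "unramified_covering E p (sym_power C :: ('d \<Rightarrow> (complex ^ 'n) set) set holspace)"
    and f: "hol E (topspace (topol E)) f"
    and v_der: "\<And>z. z \<in> ball 0 1 \<Longrightarrow> \<exists>D. (v has_derivative (\<lambda>h. \<chi> i. h *s D i)) (at z)"
    and v_in: "\<And>z i. z \<in> ball 0 1 \<Longrightarrow> v z $ i \<in> affine_cone C"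
    and s: "continuous_map (top_of_set (ball 0 1)) (topol E) s"
    and ps: "\<And>z. z \<in> ball 0 1 \<Longrightarrow> p (s z) = vec_orbit (v z)"
  shows "(\<lambda>z. f (s z)) holomorphic_on ball 0 1"
proof (rule holomorphic_onI)
  fix z :: complex assume z: "z \<in> ball 0 1"
  let ?T = "tuple_topology C :: ('d \<Rightarrow> (complex ^ 'n) set) topology"
  let ?y = "\<lambda>z i. proj_point (v z $ i)"
  have s_in: "s z \<in> topspace (topol E)" using s z by (auto simp: continuous_map_def)
  have "pullback_hol (topol E) p (sym_power C) (topspace (topol E)) f"
    using cov f unfolding unramified_covering_def by blast
  from bspec[OF this[unfolded pullback_hol_def] s_in]
  obtain V U g where V: "openin (topol E) V" "s z \<in> V"
    and U: "openin (topol (sym_power C)) U" "p ` V \<subseteq> U"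
    and g: "hol (sym_power C) U g" "\<forall>e\<in>V. f e = g (p e)"
    by (elim exE conjE)
  define W where "W = {y \<in> topspace ?T. sym_orbit y \<in> U}"
  have "hol (cartesian_power C) W (g \<circ> sym_orbit)"
    using g(1) by (simp add: sym_power_def hol_quotient_def topol_cartesian_power W_def)
  then have pb: "pullback_hol ?T (\<lambda>x. x) multiproj_space W (g \<circ> sym_orbit)"
    by (simp add: cartesian_power_def hol_subspace_def tuple_topology_def tuples_def multiproj_space_def)
  have "?y z \<in> W"
  proof -
    have "vec_orbit (v z) \<in> U" using ps[OF z] V U by (metis image_subset_iff)
    then show ?thesis using v_in[OF z]
      by (auto simp: W_def topspace_tuple_topology[OF C] tuples_def affine_cone_def vec_orbit_def)
  qed
  from bspec[OF pb[unfolded pullback_hol_def] this]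
  obtain V' U' G where V': "openin ?T V'" "?y z \<in> V'"
    and U': "(\<lambda>x. x) ` V' \<subseteq> U'" and G: "hol multiproj_space U' G" "\<forall>y\<in>V'. (g \<circ> sym_orbit) y = G y"
    by (elim exE conjE)
  let ?G = "\<lambda>x. G (\<lambda>i. proj_point (x $ i))"
  have "holomorphic_vars ?G {x. (\<forall>i. x $ i \<noteq> 0) \<and> (\<lambda>i. proj_point (x $ i)) \<in> U'}"
    using G(1) by (simp add: multiproj_space_def)
  moreover have "v z \<in> {x. (\<forall>i. x $ i \<noteq> 0) \<and> (\<lambda>i. proj_point (x $ i)) \<in> U'}"
    using v_in[OF z] V' U' by (auto simp: affine_cone_def)
  ultimately obtain D where D: "(?G has_derivative D) (at (v z))" "\<And>c u. D (\<chi> i. c *s u $ i) = c * D u"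
    unfolding holomorphic_vars_def by blast
  obtain a where a: "(v has_derivative (\<lambda>h. \<chi> i. h *s a i)) (at z)" using v_der[OF z] by blast
  have "D (\<chi> i. h *s a i) = h * D (\<chi> i. a i)" for h using D(2)[of h "\<chi> i. a i"] by simp
  with has_derivative_compose[OF a D(1)]
  have "((\<lambda>z. ?G (v z)) has_derivative (\<lambda>h. h * D (\<chi> i. a i))) (at z)" by simp
  then have der: "((\<lambda>z. ?G (v z)) has_field_derivative D (\<chi> i. a i)) (at z)"
    by (simp add: has_field_derivative_def mult_commute_abs)
  have v_cont: "continuous_on (ball 0 1) v"
    using v_der by (meson continuous_at_imp_continuous_on has_derivative_continuous)
  have y_cont: "continuous_map (top_of_set (ball 0 1)) ?T ?y"
  proof (rule continuous_map_compose[OF _ continuous_map_vec_tuple, unfolded o_def])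
    show "continuous_map (top_of_set (ball 0 1)) (top_of_set {v. \<forall>i. v $ i \<in> affine_cone C}) v"
      using v_cont v_in by auto
  qed
  let ?N = "{w \<in> topspace (top_of_set (ball 0 1)). s w \<in> V} \<inter> {w \<in> topspace (top_of_set (ball 0 1)). ?y w \<in> V'}"
  have "openin (top_of_set (ball 0 1)) ?N"
    by (intro openin_Int openin_continuous_map_preimage[OF s] openin_continuous_map_preimage[OF y_cont] V V')
  then have N: "open ?N" using openin_open_trans by blast
  have zN: "z \<in> ?N" using z V V' by simp
  have eq: "?G (v w) = f (s w)" if "w \<in> ?N" for w
  proof -
    have "f (s w) = g (vec_orbit (v w))" using g(2) ps that by simp
    then show ?thesis using G(2) that by (simp add: vec_orbit_def)
  qed
  have "((\<lambda>z. f (s z)) has_field_derivative D (\<chi> i. a i)) (at z)"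
    by (rule has_field_derivative_transform_within_open[OF der N zN eq])
  then show "(\<lambda>z. f (s z)) field_differentiable at z within ball 0 1"
    using field_differentiable_at_within field_differentiable_def by blast
qed

text \<open>The discs \<open>\<phi> i\<close> are small with respect to the covering \<open>E\<close>: all products of \<open>d\<close> of them, with
  repetitions, map into evenly covered sets.\<close>

locale charted_cover =
  fixes C :: "(complex ^ 'n) set set" and E :: "'e holspace" and p :: "'e \<Rightarrow> ('d::finite \<Rightarrow> (complex ^ 'n) set) set"
    and I :: "'i set" and \<phi> :: "'i \<Rightarrow> complex \<Rightarrow> complex ^ 'n" and \<Omega> :: "'i \<Rightarrow> (complex ^ 'n) set"
  assumes C_sub: "C \<subseteq> proj_space"
    and C_conn: "connected_space (subtopology proj_topology C)"
    and cov: "unramified_covering E p (sym_power C)"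
    and fin_I: "finite I"
    and charts: "\<And>i. i \<in> I \<Longrightarrow> chart C (\<phi> i) (\<Omega> i)"
    and \<Omega>_cover: "\<And>L. L \<in> C \<Longrightarrow> \<exists>i\<in>I. L \<in> proj_point ` (\<Omega> i \<inter> affine_cone C)"
    and small: "\<And>\<iota> :: 'd \<Rightarrow> 'i. range \<iota> \<subseteq> I \<Longrightarrow> \<exists>U. evenly_covered (topol E) p (topol (sym_power C)) U \<and>
        (\<forall>v. (\<forall>k. v $ k \<in> \<phi> (\<iota> k) ` ball 0 1) \<longrightarrow> vec_orbit v \<in> U)"
begin

definition pt :: "'i \<Rightarrow> complex \<Rightarrow> (complex ^ 'n) set"
  where "pt i z = proj_point (\<phi> i z)"

lemma covering: "covering_map (topol E) p (topol (sym_power C))"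
  using cov by (simp add: unramified_covering_def)

lemma \<phi>_cone: "i \<in> I \<Longrightarrow> norm z < 1 \<Longrightarrow> \<phi> i z \<in> affine_cone C"
  using charts[of i] by (simp add: chart_def image_subset_iff)

lemma pt_in: "i \<in> I \<Longrightarrow> norm z < 1 \<Longrightarrow> pt i z \<in> C"
  using \<phi>_cone by (simp add: pt_def affine_cone_def)

lemma \<Omega>_pt: "i \<in> I \<Longrightarrow> L \<in> proj_point ` (\<Omega> i \<inter> affine_cone C) \<Longrightarrow> \<exists>z. norm z < 1/2 \<and> pt i z = L"
  using charts unfolding chart_def pt_def by (metis (no_types, lifting) imageE)

lemma pt_cover: "L \<in> C \<Longrightarrow> \<exists>i\<in>I. \<exists>z. norm z < 1/2 \<and> pt i z = L"
  using \<Omega>_cover \<Omega>_pt by blast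

lemma pt_cover_1: "L \<in> C \<Longrightarrow> \<exists>i\<in>I. \<exists>z. norm z < 1 \<and> pt i z = L"
proof -
  assume "L \<in> C"
  then obtain i z where "i \<in> I" "norm z < 1/2" "pt i z = L" using pt_cover by blast
  moreover then have "norm z < 1" by simp
  ultimately show ?thesis by blast
qed

lemma \<phi>_continuous: "i \<in> I \<Longrightarrow> continuous_on (ball 0 1) (\<phi> i)"
  using charts unfolding chart_def holomorphic_curve_def
  by (meson continuous_at_imp_continuous_on has_derivative_continuous)

text \<open>The part of \<open>C\<close> in \<open>\<Omega> i\<close> lies in a single disc, so \<open>P\<close> is locally constant on the connected space \<open>C\<close>.\<close>

lemma chain:
  assumes P: "P x" and x: "x \<in> C" and y: "y \<in> C"
    and step: "\<And>i z z'. \<lbrakk>i \<in> I; norm z < 1; norm z' < 1; P (pt i z)\<rbrakk> \<Longrightarrow> P (pt i z')"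
  shows "P y"
proof -
  let ?X = "subtopology proj_topology C"
  let ?nb = "\<lambda>i. proj_point ` (\<Omega> i \<inter> affine_cone C)"
  have top: "topspace ?X = C" using C_sub by (simp add: topspace_proj_topology Int_absorb1)
  have nb: "openin ?X (?nb i)" if "i \<in> I" for i
    using charts[OF that] openin_curve_image[OF C_sub] by (simp add: chart_def)
  have same: "P L \<longleftrightarrow> P L'" if i: "i \<in> I" and L: "L \<in> ?nb i" "L' \<in> ?nb i" for i L L'
  proof -
    obtain z z' where "norm z < 1/2" "pt i z = L" "norm z' < 1/2" "pt i z' = L'"
      using \<Omega>_pt[OF i L(1)] \<Omega>_pt[OF i L(2)] by blast
    then show ?thesis using step[of i z z'] step[of i z' z] i by auto
  qed
  have op: "openin ?X {L \<in> C. P L = b}" for b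
  proof (subst openin_subopen, intro ballI)
    fix L assume L: "L \<in> {L \<in> C. P L = b}"
    then obtain i where i: "i \<in> I" "L \<in> ?nb i" using \<Omega>_cover by blast
    have "?nb i \<subseteq> C" by (auto simp: affine_cone_def)
    then have "?nb i \<subseteq> {L \<in> C. P L = b}" using same[OF i(1) i(2)] L by blast
    then show "\<exists>N. openin ?X N \<and> L \<in> N \<and> N \<subseteq> {L \<in> C. P L = b}" using nb i by blast
  qed
  have "topspace ?X - {L \<in> C. P L = True} = {L \<in> C. P L = False}" unfolding top by blast
  then have "closedin ?X {L \<in> C. P L = True}" unfolding closedin_def using op[of False] top by auto
  then have "{L \<in> C. P L = True} = {} \<or> {L \<in> C. P L = True} = C"
    using C_conn op[of True] unfolding connected_space_clopen_in top by blast
  then show ?thesis using P x y by blast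
qed

definition lift :: "'b::topological_space set \<Rightarrow> ('b \<Rightarrow> ('d \<Rightarrow> (complex ^ 'n) set)) \<Rightarrow> ('b \<Rightarrow> 'e) \<Rightarrow> bool"
  where "lift S c s \<longleftrightarrow> continuous_map (top_of_set S) (topol E) s \<and> (\<forall>z\<in>S. p (s z) = sym_orbit (c z))"

lemma lift_in: "lift S c s \<Longrightarrow> z \<in> S \<Longrightarrow> s z \<in> topspace (topol E)"
  by (auto simp: lift_def continuous_map_def)

lemma lift_eq:
  assumes "lift S c s" "lift S c s'" "connected S" "z \<in> S" "s z = s' z" "w \<in> S"
  shows "s w = s' w"
proof (rule lift_unique[OF covering, of "top_of_set S" s s' z w])
  show "connected_space (top_of_set S)"
    using assms(3) by (simp flip: connectedin_topspace add: connectedin_subtopology)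
qed (use assms in \<open>auto simp: lift_def\<close>)

text \<open>This is where smallness of the discs enters: \<open>\<iota>\<close> assigns to each of the \<open>d\<close> coordinates the disc in
  which it stays.\<close>

lemma lift_exists_box:
  fixes v :: "'b::topological_space \<Rightarrow> complex ^ 'n ^ 'd"
  assumes \<iota>: "range \<iota> \<subseteq> I"
    and v: "continuous_on S v" "\<And>z k. z \<in> S \<Longrightarrow> v z $ k \<in> \<phi> (\<iota> k) ` ball 0 1"
    and c: "\<And>z k. z \<in> S \<Longrightarrow> c z k = proj_point (v z $ k)"
    and e: "e \<in> topspace (topol E)" "z \<in> S" "p e = sym_orbit (c z)"
  obtains s where "lift S c s" "s z = e"
proof -
  obtain U where U: "evenly_covered (topol E) p (topol (sym_power C)) U"
    "\<And>v. (\<forall>k. v $ k \<in> \<phi> (\<iota> k) ` ball 0 1) \<Longrightarrow> vec_orbit v \<in> U" using small[OF \<iota>] by blast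
  have c': "vec_orbit (v z) = sym_orbit (c z)" if "z \<in> S" for z
  proof -
    have "c z = (\<lambda>k. proj_point (v z $ k))" using c[OF that] by blast
    then show ?thesis by (simp add: vec_orbit_def)
  qed
  have "\<iota> k \<in> I" for k using \<iota> by blast
  then have "v z $ k \<in> affine_cone C" if "z \<in> S" for z k
    using v(2)[OF that, of k] \<phi>_cone by auto
  then have "continuous_map (top_of_set S) (top_of_set {v. \<forall>i. v $ i \<in> affine_cone C}) v"
    using v(1) by auto
  then have 1: "continuous_map (top_of_set S) (topol (sym_power C)) (\<lambda>z. vec_orbit (v z))"
    by (rule continuous_map_compose[OF _ continuous_map_vec_orbit, unfolded o_def])
  have 2: "(\<lambda>z. vec_orbit (v z)) ` topspace (top_of_set S) \<subseteq> U" using U(2) v(2) by auto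
  have 3: "z \<in> topspace (top_of_set S)" "p e = vec_orbit (v z)" using e c' by auto
  obtain s where s: "continuous_map (top_of_set S) (topol E) s"
      "\<forall>w\<in>topspace (top_of_set S). p (s w) = vec_orbit (v w)" "s z = e"
    using lift_exists[OF U(1) 1 2 e(1) 3] .
  then have "lift S c s" using c' by (simp add: lift_def)
  then show ?thesis using that s(3) by blast
qed

lemma chart_rep:
  assumes "y \<in> tuples C"
  obtains \<iota> r where "range \<iota> \<subseteq> I" "\<And>k :: 'd. r k \<in> \<phi> (\<iota> k) ` ball 0 1" "\<And>k. y k = proj_point (r k)"
proof -
  have "\<forall>k. \<exists>i z. i \<in> I \<and> norm z < 1 \<and> pt i z = y k"
    using pt_cover_1 assms unfolding tuples_def by blast
  then obtain \<iota> \<zeta> where "\<And>k. \<iota> k \<in> I \<and> norm (\<zeta> k) < 1 \<and> pt (\<iota> k) (\<zeta> k) = y k" by metis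
  then show ?thesis using that[of \<iota> "\<lambda>k. \<phi> (\<iota> k) (\<zeta> k)"] by (auto simp: pt_def)
qed

lemma lift_exists_1:
  assumes y: "y \<in> tuples C" and i: "i \<in> I" and e: "e \<in> topspace (topol E)" "norm z < 1" "p e = sym_orbit (y(k := pt i z))"
  obtains s where "lift (ball 0 1) (\<lambda>z. y(k := pt i z)) s" "s z = e"
proof -
  obtain \<iota> r where r: "range \<iota> \<subseteq> I" "\<And>k. r k \<in> \<phi> (\<iota> k) ` ball 0 1" "\<And>k. y k = proj_point (r k)"
    using chart_rep[OF y] by blast
  show ?thesis
  proof (rule lift_exists_box[of "\<iota>(k := i)" "ball 0 1" "\<lambda>z. \<chi> l. if l = k then \<phi> i z else r l" "\<lambda>z. y(k := pt i z)" e z])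
    show "continuous_on (ball 0 1) (\<lambda>z. \<chi> l. if l = k then \<phi> i z else r l)"
    proof (intro continuous_on_vec_lambda)
      show "continuous_on (ball 0 1) (\<lambda>z. if l = k then \<phi> i z else r l)" for l
        using \<phi>_continuous[OF i] by (cases "l = k") auto
    qed
  qed (use r i e that in \<open>auto simp: pt_def\<close>)
qed

lemma lift_exists_2:
  assumes y: "y \<in> tuples C" and i: "i \<in> I" "j \<in> I" "k \<noteq> l"
    and e: "e \<in> topspace (topol E)" "norm z < 1" "norm u < 1" "p e = sym_orbit (y(k := pt i z, l := pt j u))"
  obtains s where "lift (ball 0 1 \<times> ball 0 1) (\<lambda>(z, u). y(k := pt i z, l := pt j u)) s" "s (z, u) = e"
proof -
  obtain \<iota> r where r: "range \<iota> \<subseteq> I" "\<And>k. r k \<in> \<phi> (\<iota> k) ` ball 0 1" "\<And>k. y k = proj_point (r k)"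
    using chart_rep[OF y] by blast
  show ?thesis
  proof (rule lift_exists_box[of "\<iota>(k := i, l := j)" "ball 0 1 \<times> ball 0 1"
        "\<lambda>z. \<chi> m. if m = l then \<phi> j (snd z) else if m = k then \<phi> i (fst z) else r m"
        "\<lambda>(z, u). y(k := pt i z, l := pt j u)" e "(z, u)"])
    show "continuous_on (ball 0 1 \<times> ball 0 1)
        (\<lambda>z. \<chi> m. if m = l then \<phi> j (snd z) else if m = k then \<phi> i (fst z) else r m)"
    proof (intro continuous_on_vec_lambda)
      have "continuous_on (ball 0 1 \<times> ball 0 1) (\<lambda>z. \<phi> j (snd z))" "continuous_on (ball 0 1 \<times> ball 0 1) (\<lambda>z. \<phi> i (fst z))"
        by (intro continuous_on_compose2[OF \<phi>_continuous] i continuous_intros; force)+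
      then show "continuous_on (ball 0 1 \<times> ball 0 1)
          (\<lambda>z. if m = l then \<phi> j (snd z) else if m = k then \<phi> i (fst z) else r m)" for m
        by (cases "m = l"; cases "m = k") auto
    qed
  qed (use r i e that in \<open>auto simp: pt_def\<close>)
qed

lemma lift_holomorphic:
  assumes f: "hol E (topspace (topol E)) f" and y: "y \<in> tuples C" and i: "i \<in> I"
    and s: "lift (ball 0 1) (\<lambda>z. y(k := pt i z)) s"
  shows "(\<lambda>z. f (s z)) holomorphic_on ball 0 1"
proof -
  obtain \<iota> r where r: "range \<iota> \<subseteq> I" "\<And>k. r k \<in> \<phi> (\<iota> k) ` ball 0 1" "\<And>k. y k = proj_point (r k)"
    using chart_rep[OF y] by blast
  have \<iota>: "\<iota> k \<in> I" for k using r(1) by blast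
  define v where "v z = (\<chi> l. if l = k then \<phi> i z else r l)" for z
  define J :: "complex ^ 'n \<Rightarrow> complex ^ 'n ^ 'd" where "J a = (\<chi> l. if l = k then a else 0)" for a
  have J: "bounded_linear J"
    unfolding linear_conv_bounded_linear[symmetric] by (rule linearI) (auto simp: J_def vec_eq_iff)
  have v: "v = (\<lambda>z. (\<chi> l. if l = k then 0 else r l) + J (\<phi> i z))"
    by (auto simp: v_def J_def vec_eq_iff)
  show ?thesis
  proof (rule hol_lift_holomorphic[OF C_sub cov f, of v])
    fix z :: complex assume z: "z \<in> ball 0 1"
    then obtain a where "(\<phi> i has_derivative (\<lambda>h. h *s a)) (at z)"
      using charts[OF i] unfolding chart_def holomorphic_curve_def by blast
    then have "(v has_derivative (\<lambda>h. J (h *s a))) (at z)"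
      unfolding v by (auto intro!: derivative_eq_intros bounded_linear.has_derivative[OF J])
    moreover have "J (h *s a) = (\<chi> l. h *s (if l = k then a else 0))" for h
      by (auto simp: J_def vec_eq_iff)
    ultimately have "(v has_derivative (\<lambda>h. \<chi> l. h *s (if l = k then a else 0))) (at z)" by simp
    then show "\<exists>D. (v has_derivative (\<lambda>h. \<chi> l. h *s D l)) (at z)"
      by (rule exI[of _ "\<lambda>l. if l = k then a else 0"])
    show "v z $ l \<in> affine_cone C" for l
      using z r(2)[of l] \<phi>_cone[OF i, of z] \<phi>_cone[OF \<iota>] by (auto simp: v_def)
    have "(\<lambda>l. proj_point (v z $ l)) = y(k := pt i z)"
      by (simp add: fun_eq_iff v_def pt_def r(3))
    then show "p (s z) = vec_orbit (v z)" using s z by (simp add: lift_def vec_orbit_def)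
  qed (use s in \<open>simp add: lift_def\<close>)
qed

lemma tuples_upd: "y \<in> tuples C \<Longrightarrow> L \<in> C \<Longrightarrow> y(k := L) \<in> tuples C"
  by (simp add: tuples_def)

text \<open>The source of the symmetry of the fibres.\<close>

lemma sym_orbit_swap: "k \<noteq> l \<Longrightarrow> sym_orbit (y(k := a, l := b)) = sym_orbit (y(k := b, l := a))" for y :: "'d \<Rightarrow> 'x"
proof -
  assume "k \<noteq> l"
  then have "y(k := b, l := a) = y(k := a, l := b) \<circ> Transposition.transpose k l"
    by (auto simp: fun_eq_iff Transposition.transpose_def)
  then show ?thesis by (simp add: sym_orbit_permute permutes_swap_id)
qed

text \<open>By uniqueness of lifts over the disc, the choice of \<open>s\<close> does not matter.\<close>

definition slot_transport :: "('d \<Rightarrow> (complex ^ 'n) set) \<Rightarrow> 'd \<Rightarrow> 'i \<Rightarrow> complex \<Rightarrow> complex \<Rightarrow> 'e \<Rightarrow> 'e"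
  where "slot_transport y k i z z' e = (SOME s. lift (ball 0 1) (\<lambda>w. y(k := pt i w)) s \<and> s z = e) z'"

lemma slot_transport_eq:
  assumes s: "lift (ball 0 1) (\<lambda>w. y(k := pt i w)) s" and z: "norm z < 1" "norm z' < 1" and e: "s z = e"
  shows "slot_transport y k i z z' e = s z'"
proof -
  let ?P = "\<lambda>s. lift (ball 0 1) (\<lambda>w. y(k := pt i w)) s \<and> s z = e"
  define s0 where "s0 = (SOME s. ?P s)"
  have "\<exists>s. ?P s" using s e by blast
  then have s0: "?P s0" unfolding s0_def by (rule someI_ex)
  have "s0 z' = s z'" by (rule lift_eq[of "ball 0 1" _ s0 s z]) (use s0 s z e in auto)
  then show ?thesis unfolding slot_transport_def s0_def .
qed

text \<open>The point moving in slot \<open>k\<close> is the first point, the one in slot \<open>l\<close> the second. Commutativity holds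
  because both sides are the values of one lift over a product of two discs.\<close>

lemma slot_transport_two_slot:
  assumes f: "hol E (topspace (topol E)) f" and B: "\<And>e. e \<in> topspace (topol E) \<Longrightarrow> norm (f e) \<le> B"
    and y: "y \<in> tuples C" and kl: "k \<noteq> l"
  shows "two_slot_transport I pt C (\<lambda>x x'. {e \<in> topspace (topol E). p e = sym_orbit (y(k := x, l := x'))})
    (\<lambda>i z z' x'. slot_transport (y(l := x')) k i z z') f B"
proof unfold_locales
  let ?Fib = "\<lambda>x x'. {e \<in> topspace (topol E). p e = sym_orbit (y(k := x, l := x'))}"
  let ?t = "\<lambda>i z z' x'. slot_transport (y(l := x')) k i z z'"
  have twist: "y(k := a, l := b) = y(l := b, k := a)" for a b using kl by (rule fun_upd_twist)
  have ex: "\<exists>s. lift (ball 0 1) (\<lambda>w. y(l := x', k := pt i w)) s \<and> s z = e \<and> (\<forall>z'. norm z' < 1 \<longrightarrow> ?t i z z' x' e = s z')"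
    if "i \<in> I" "norm z < 1" "x' \<in> C" "e \<in> ?Fib (pt i z) x'" for i z x' e
  proof -
    have "e \<in> topspace (topol E)" "p e = sym_orbit (y(l := x', k := pt i z))"
      using that(4) by (auto simp: twist)
    from lift_exists_1[OF tuples_upd[OF y that(3)] that(1) this(1) that(2) this(2)]
    obtain s where "lift (ball 0 1) (\<lambda>w. y(l := x', k := pt i w)) s" "s z = e" .
    then show ?thesis using slot_transport_eq that(2) by blast
  qed
  show "finite I" by (rule fin_I)
  show "pt i z \<in> C" if "i \<in> I" "norm z < 1" for i z using that by (rule pt_in)
  show "\<exists>i\<in>I. \<exists>z. norm z < 1/2 \<and> pt i z = x" if "x \<in> C" for x using that by (rule pt_cover)
  show "P x'" if "P x" "x \<in> C" "x' \<in> C"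
    "\<And>i z z'. \<lbrakk>i \<in> I; norm z < 1; norm z' < 1; P (pt i z)\<rbrakk> \<Longrightarrow> P (pt i z')" for P x x'
    using that by (rule chain)
  show "?Fib x x' = ?Fib x' x" for x x' using sym_orbit_swap[OF kl] by metis
  show "?t i z z' x' e \<in> ?Fib (pt i z') x'"
    if a: "i \<in> I" "norm z < 1" "norm z' < 1" "x' \<in> C" "e \<in> ?Fib (pt i z) x'" for i z z' x' e
  proof -
    obtain s where s: "lift (ball 0 1) (\<lambda>w. y(l := x', k := pt i w)) s" "?t i z z' x' e = s z'"
      using ex[OF a(1,2,4,5)] a(3) by blast
    have z': "z' \<in> ball 0 1" using a(3) by simp
    then have "p (s z') = sym_orbit (y(k := pt i z', l := x'))" using s(1) by (simp add: lift_def twist)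
    then show ?thesis using lift_in[OF s(1) z'] s(2) by simp
  qed
  show "?t i z z x' e = e"
    if "i \<in> I" "norm z < 1" "x' \<in> C" "e \<in> ?Fib (pt i z) x'" for i z x' e
    using ex[OF that] that(2) by auto
  show "?t i z' z x' (?t i z z' x' e) = e"
    if a: "i \<in> I" "norm z < 1" "norm z' < 1" "x' \<in> C" "e \<in> ?Fib (pt i z) x'" for i z z' x' e
  proof -
    obtain s where s: "lift (ball 0 1) (\<lambda>w. y(l := x', k := pt i w)) s" "s z = e" "?t i z z' x' e = s z'"
      using ex[OF a(1,2,4,5)] a(3) by blast
    show ?thesis using slot_transport_eq[OF s(1) a(3,2) refl] s by simp
  qed
  show "?t j u u' (pt i z') (?t i z z' (pt j u) e) = ?t i z z' (pt j u') (?t j u u' (pt i z) e)"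
    if i: "i \<in> I" "norm z < 1" "norm z' < 1" and j: "j \<in> I" "norm u < 1" "norm u' < 1"
      and e: "e \<in> ?Fib (pt i z) (pt j u)" for i z z' j u u' e
  proof -
    have "e \<in> topspace (topol E)" "p e = sym_orbit (y(k := pt i z, l := pt j u))" using e by auto
    from lift_exists_2[OF y i(1) j(1) kl this(1) i(2) j(2) this(2)]
    obtain s where s: "lift (ball 0 1 \<times> ball 0 1) (\<lambda>(z, u). y(k := pt i z, l := pt j u)) s" "s (z, u) = e" .
    have cont: "continuous_map (top_of_set (ball 0 1)) (topol E) (s \<circ> g)"
      if "continuous_on (ball 0 1) g" "g ` ball 0 1 \<subseteq> ball 0 1 \<times> ball 0 1" for g :: "complex \<Rightarrow> complex \<times> complex"
      by (rule continuous_map_compose[where X' = "top_of_set (ball 0 1 \<times> ball 0 1)"])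
        (use that s in \<open>auto simp: lift_def\<close>)
    have p_s: "p (s (w, v)) = sym_orbit (y(k := pt i w, l := pt j v))" if "norm w < 1" "norm v < 1" for w v
      using s(1) that by (auto simp: lift_def)
    have s_i: "lift (ball 0 1) (\<lambda>w. y(l := pt j v, k := pt i w)) (\<lambda>w. s (w, v))" if v: "norm v < 1" for v
    proof -
      have "continuous_on (ball 0 1) (\<lambda>w. (w, v))" by (intro continuous_intros)
      moreover have "(\<lambda>w. (w, v)) ` ball 0 1 \<subseteq> ball 0 1 \<times> ball 0 1" using v by auto
      ultimately have "continuous_map (top_of_set (ball 0 1)) (topol E) (\<lambda>w. s (w, v))"
        using cont[of "\<lambda>w. (w, v)"] by (simp only: o_def)
      then show ?thesis using p_s[OF _ v] by (simp add: lift_def twist)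
    qed
    have s_j: "lift (ball 0 1) (\<lambda>w. y(l := pt i v, k := pt j w)) (\<lambda>w. s (v, w))" if v: "norm v < 1" for v
    proof -
      have "continuous_on (ball 0 1) (\<lambda>w. (v, w))" by (intro continuous_intros)
      moreover have "(\<lambda>w. (v, w)) ` ball 0 1 \<subseteq> ball 0 1 \<times> ball 0 1" using v by auto
      ultimately have "continuous_map (top_of_set (ball 0 1)) (topol E) (\<lambda>w. s (v, w))"
        using cont[of "\<lambda>w. (v, w)"] by (simp only: o_def)
      moreover have "sym_orbit (y(k := pt i v, l := pt j w)) = sym_orbit (y(l := pt i v, k := pt j w))" for w
        using sym_orbit_swap[OF kl, of y "pt i v" "pt j w"] twist[of "pt j w" "pt i v"] by simp
      ultimately show ?thesis using p_s[OF v] by (simp add: lift_def)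
    qed
    have "?t i z z' (pt j u) e = s (z', u)"
      using slot_transport_eq[OF s_i[OF j(2)] i(2,3)] s(2) by simp
    moreover have "?t j u u' (pt i z') (s (z', u)) = s (z', u')"
      using slot_transport_eq[OF s_j[OF i(3)] j(2,3)] by simp
    moreover have "?t j u u' (pt i z) e = s (z, u')"
      using slot_transport_eq[OF s_j[OF i(2)] j(2,3)] s(2) by simp
    moreover have "?t i z z' (pt j u') (s (z, u')) = s (z', u')"
      using slot_transport_eq[OF s_i[OF j(3)] i(2,3)] by simp
    ultimately show ?thesis by simp
  qed
  show "(\<lambda>z'. f (?t i z z' x' e)) holomorphic_on ball 0 1"
    if a: "i \<in> I" "norm z < 1" "x' \<in> C" "e \<in> ?Fib (pt i z) x'" for i z x' e
  proof -
    obtain s where s: "lift (ball 0 1) (\<lambda>w. y(l := x', k := pt i w)) s"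
      "\<forall>z'. norm z' < 1 \<longrightarrow> ?t i z z' x' e = s z'" using ex[OF a] by blast
    have "(\<lambda>z'. f (s z')) holomorphic_on ball 0 1"
      by (rule lift_holomorphic[OF f tuples_upd[OF y a(3)] a(1) s(1)])
    then show ?thesis by (rule holomorphic_transform) (use s(2) in simp)
  qed
  show "norm (f e) \<le> B" if "e \<in> ?Fib x x'" for x x' e using B that by simp
qed

text \<open>A second slot exists as \<open>d \<ge> 2\<close>.\<close>

lemma slot_invariant:
  assumes d: "CARD('d) \<ge> 2"
    and f: "hol E (topspace (topol E)) f" and B: "\<And>e. e \<in> topspace (topol E) \<Longrightarrow> norm (f e) \<le> B"
    and y: "y \<in> tuples C" and i: "i \<in> I" and s: "lift (ball 0 1) (\<lambda>w. y(k := pt i w)) s"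
    and z: "norm z < 1" "norm z' < 1"
  shows "f (s z') = f (s z)"
proof -
  have "\<exists>l. k \<noteq> l"
  proof (rule ccontr)
    assume "\<nexists>l. k \<noteq> l"
    then have "(UNIV :: 'd set) = {k}" by auto
    then have "CARD('d) = card {k}" by (rule arg_cong)
    then show False using d by simp
  qed
  then obtain l where kl: "k \<noteq> l" by blast
  have y_l: "y l \<in> C" using y by (simp add: tuples_def)
  have "s z \<in> topspace (topol E)" "p (s z) = sym_orbit (y(k := pt i z))"
    using lift_in[OF s, of z] s z(1) by (simp_all add: lift_def)
  moreover have "y(k := pt i z) = y(k := pt i z, l := y l)" using kl by (auto simp: fun_eq_iff)
  ultimately have e: "s z \<in> {e \<in> topspace (topol E). p e = sym_orbit (y(k := pt i z, l := y l))}" by simp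
  have "slot_transport (y(l := y l)) k i z z' (s z) = s z'"
    using slot_transport_eq[OF _ z refl] s by simp
  then show ?thesis
    using two_slot_transport.transport_invariant[OF slot_transport_two_slot[OF f B y kl] i z y_l e] by simp
qed

text \<open>Near \<open>e\<close> the covering is parametrised by a product of \<open>d\<close> discs through \<open>s\<close>, and any two points of
  the product are connected by changing one coordinate after the other.\<close>

lemma locally_constant:
  assumes d: "CARD('d) \<ge> 2"
    and f: "hol E (topspace (topol E)) f" and B: "\<And>e. e \<in> topspace (topol E) \<Longrightarrow> norm (f e) \<le> B"
    and e: "e \<in> topspace (topol E)"
  shows "\<exists>N. openin (topol E) N \<and> e \<in> N \<and> (\<forall>e'\<in>N. f e' = f e)"
proof -
  let ?nb = "\<lambda>i. proj_point ` (\<Omega> i \<inter> affine_cone C)"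
  let ?T = "tuple_topology C :: ('d \<Rightarrow> (complex ^ 'n) set) topology"
  have p_cont: "continuous_map (topol E) (topol (sym_power C)) p"
    using covering by (simp add: covering_map_def)
  have "p e \<in> topspace (topol (sym_power C))" using p_cont e by (auto simp: continuous_map_def)
  then obtain y where y: "y \<in> tuples C" "p e = sym_orbit y" unfolding topspace_sym_power[OF C_sub] by blast
  have "\<forall>k. \<exists>i. i \<in> I \<and> y k \<in> ?nb i" using \<Omega>_cover y unfolding tuples_def by blast
  then obtain \<iota> where \<iota>: "\<And>k. \<iota> k \<in> I" "\<And>k. y k \<in> ?nb (\<iota> k)" by metis
  then have "range \<iota> \<subseteq> I" by blast
  from small[OF this] obtain U where U: "evenly_covered (topol E) p (topol (sym_power C)) U"
    "\<And>v. (\<forall>k. v $ k \<in> \<phi> (\<iota> k) ` ball 0 1) \<Longrightarrow> vec_orbit v \<in> U" by blast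
  define O' where "O' = {y' \<in> tuples C. \<forall>k. y' k \<in> ?nb (\<iota> k)}"
  have top: "topspace ?T = tuples C" by (rule topspace_tuple_topology[OF C_sub])
  have "openin ?T (\<Inter>k\<in>UNIV. {y' \<in> topspace ?T. y' k \<in> ?nb (\<iota> k)})"
  proof (intro openin_INT2 finite openin_continuous_map_preimage[OF continuous_map_tuple_nth])
    show "openin (subtopology proj_topology C) (?nb (\<iota> k))" for k
      using charts[OF \<iota>(1)] openin_curve_image[OF C_sub] by (simp add: chart_def)
  qed auto
  moreover have "O' = (\<Inter>k\<in>UNIV. {y' \<in> topspace ?T. y' k \<in> ?nb (\<iota> k)})" unfolding top O'_def by auto
  ultimately have O': "openin (topol (sym_power C)) (sym_orbit ` O')"
    using openin_sym_image[OF C_sub] by simp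
  define S where "S = {\<zeta> :: complex ^ 'd. \<forall>k. norm (\<zeta> $ k) < 1}"
  define v where "v \<zeta> = (\<chi> k. \<phi> (\<iota> k) (\<zeta> $ k))" for \<zeta> :: "complex ^ 'd"
  define c where "c \<zeta> k = pt (\<iota> k) (\<zeta> $ k)" for \<zeta> :: "complex ^ 'd" and k
  have c_v: "sym_orbit (c \<zeta>) = vec_orbit (v \<zeta>)" for \<zeta>
    unfolding vec_orbit_def by (rule arg_cong[of _ _ sym_orbit]) (auto simp: c_def v_def pt_def)
  have c_U: "sym_orbit (c \<zeta>) \<in> U" if "\<zeta> \<in> S" for \<zeta>
    unfolding c_v using that by (intro U(2)) (auto simp: S_def v_def)
  have c_in: "c \<zeta> \<in> tuples C" if "\<zeta> \<in> S" for \<zeta>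
    using that pt_in \<iota>(1) by (auto simp: tuples_def c_def S_def)
  have O'_c: "\<exists>\<zeta>\<in>S. y' = c \<zeta>" if y': "y' \<in> O'" for y'
  proof -
    have "\<forall>k. \<exists>z. norm z < 1/2 \<and> pt (\<iota> k) z = y' k"
      using y' \<Omega>_pt[OF \<iota>(1)] by (simp add: O'_def)
    then obtain \<zeta> where \<zeta>: "\<And>k. norm (\<zeta> k) < 1/2 \<and> pt (\<iota> k) (\<zeta> k) = y' k" by metis
    have "norm (\<zeta> k) < 1" for k using \<zeta>[of k] by linarith
    then have "(\<chi> k. \<zeta> k) \<in> S" by (simp add: S_def)
    moreover have "y' = c (\<chi> k. \<zeta> k)" using \<zeta> by (auto simp: c_def)
    ultimately show ?thesis by blast
  qed
  have y_O': "y \<in> O'" using y \<iota>(2) by (simp add: O'_def)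
  then obtain \<zeta>0 where \<zeta>0: "\<zeta>0 \<in> S" "y = c \<zeta>0" using O'_c by blast
  have pU: "p e \<in> U" using c_U[OF \<zeta>0(1)] \<zeta>0(2) y(2) by simp
  obtain V r where V: "openin (topol E) V" "e \<in> V"
    and r: "continuous_map (subtopology (topol (sym_power C)) U) (topol E) r"
      "\<forall>D\<in>U. p (r D) = D" "\<forall>e'\<in>V. r (p e') = e'"
    using evenly_covered_section[OF U(1) e pU] .
  define s where "s \<zeta> = r (sym_orbit (c \<zeta>))" for \<zeta>
  have s_lift: "lift S c s"
    unfolding lift_def
  proof
    have "v \<zeta> $ k \<in> affine_cone C" if "\<zeta> \<in> S" for \<zeta> k
      using that \<phi>_cone[OF \<iota>(1)] by (simp add: S_def v_def)
    moreover have "continuous_on S v"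
      unfolding v_def
      by (intro continuous_on_vec_lambda continuous_on_compose2[OF \<phi>_continuous[OF \<iota>(1)]] continuous_intros)
        (auto simp: S_def)
    ultimately have "continuous_map (top_of_set S) (top_of_set {v. \<forall>i. v $ i \<in> affine_cone C}) v" by auto
    then have "continuous_map (top_of_set S) (topol (sym_power C)) (vec_orbit \<circ> v)"
      by (rule continuous_map_compose[OF _ continuous_map_vec_orbit])
    then have "continuous_map (top_of_set S) (subtopology (topol (sym_power C)) U) (vec_orbit \<circ> v)"
      using c_U by (auto simp: continuous_map_in_subtopology c_v)
    from continuous_map_compose[OF this r(1)]
    show "continuous_map (top_of_set S) (topol E) s" by (simp add: o_def s_def[abs_def] c_v)
    show "\<forall>\<zeta>\<in>S. p (s \<zeta>) = sym_orbit (c \<zeta>)" using r(2) c_U by (simp add: s_def)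
  qed
  have slot: "f (s (\<chi> l. if l = k then w else \<zeta> $ l)) = f (s \<zeta>)" if \<zeta>: "\<zeta> \<in> S" and w: "norm w < 1" for \<zeta> k w
  proof -
    let ?g = "\<lambda>w. \<chi> l. if l = k then w else \<zeta> $ l"
    have g_S: "?g w \<in> S" if "norm w < 1" for w using \<zeta> that by (simp add: S_def)
    have g_c: "c (?g w) = (c \<zeta>)(k := pt (\<iota> k) w)" for w by (auto simp: c_def fun_eq_iff)
    have "continuous_on (ball 0 1) ?g"
    proof (intro continuous_on_vec_lambda)
      show "continuous_on (ball 0 1) (\<lambda>w. if l = k then w else \<zeta> $ l)" for l
        by (cases "l = k") (auto intro: continuous_intros)
    qed
    then have "continuous_map (top_of_set (ball 0 1)) (top_of_set S) ?g" using g_S by auto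
    from continuous_map_compose[OF this, of "topol E" s] s_lift
    have "lift (ball 0 1) (\<lambda>w. (c \<zeta>)(k := pt (\<iota> k) w)) (\<lambda>w. s (?g w))"
      using g_S by (simp add: lift_def o_def flip: g_c)
    from slot_invariant[OF d f B c_in[OF \<zeta>] \<iota>(1) this, of "\<zeta> $ k" w]
    have "f (s (?g w)) = f (s (?g (\<zeta> $ k)))" using \<zeta> w by (simp add: S_def)
    moreover have "?g (\<zeta> $ k) = \<zeta>" by (auto simp: vec_eq_iff)
    ultimately show ?thesis by simp
  qed
  have const: "f (s \<zeta>) = f (s \<zeta>0)" if \<zeta>: "\<zeta> \<in> S" for \<zeta>
  proof -
    have "(\<chi> k. if k \<in> J then \<zeta> $ k else \<zeta>0 $ k) \<in> S \<and>
        f (s (\<chi> k. if k \<in> J then \<zeta> $ k else \<zeta>0 $ k)) = f (s \<zeta>0)" if "finite J" for J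
      using that
    proof (induction J rule: finite_induct)
      case empty
      then show ?case using \<zeta>0 by simp
    next
      case (insert a J)
      have "(\<chi> k. if k \<in> insert a J then \<zeta> $ k else \<zeta>0 $ k) =
          (\<chi> l. if l = a then \<zeta> $ a else (\<chi> k. if k \<in> J then \<zeta> $ k else \<zeta>0 $ k) $ l)"
        by (auto simp: vec_eq_iff)
      moreover have "(\<chi> k. if k \<in> insert a J then \<zeta> $ k else \<zeta>0 $ k) \<in> S"
        using \<zeta> \<zeta>0 by (simp add: S_def)
      ultimately show ?case using slot insert \<zeta> by (simp add: S_def)
    qed
    from this[of UNIV] show ?thesis by simp
  qed
  let ?N = "V \<inter> {e' \<in> topspace (topol E). p e' \<in> sym_orbit ` O'}"
  have N: "openin (topol E) ?N" by (intro openin_Int V openin_continuous_map_preimage[OF p_cont O'])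
  have e_N: "e \<in> ?N" using V e y y_O' by auto
  have f_N: "f e' = f (s \<zeta>0)" if e': "e' \<in> ?N" for e'
  proof -
    obtain \<zeta> where \<zeta>: "\<zeta> \<in> S" "p e' = sym_orbit (c \<zeta>)" using e' O'_c by blast
    have "r (p e') = e'" using r(3) e' by blast
    then have "e' = s \<zeta>" using \<zeta>(2) by (simp add: s_def)
    then show ?thesis using const[OF \<zeta>(1)] by simp
  qed
  have "\<forall>e'\<in>?N. f e' = f e" using f_N f_N[OF e_N] by simp
  with N e_N show ?thesis by blast
qed

theorem bounded_hol_constant:
  assumes d: "CARD('d) \<ge> 2" and conn: "connected_space (topol E)"
  shows "liouville E"
  unfolding liouville_def
proof (intro allI impI)
  fix f assume f: "hol E (topspace (topol E)) f \<and> bounded (f ` topspace (topol E))"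
  then obtain B where B: "\<And>e. e \<in> topspace (topol E) \<Longrightarrow> norm (f e) \<le> B" by (auto simp: bounded_iff)
  have loc: "\<exists>N. openin (topol E) N \<and> e \<in> N \<and> (\<forall>e'\<in>N. f e' = f e)" if "e \<in> topspace (topol E)" for e
    by (rule locally_constant[OF d conjunct1[OF f] B that])
  have op: "openin (topol E) {e \<in> topspace (topol E). f e \<in> A}" for A
  proof (subst openin_subopen, intro ballI)
    fix e assume e: "e \<in> {e \<in> topspace (topol E). f e \<in> A}"
    then obtain N where N: "openin (topol E) N" "e \<in> N" "\<forall>e'\<in>N. f e' = f e" using loc by blast
    then have "N \<subseteq> {e \<in> topspace (topol E). f e \<in> A}" using e openin_subset by fastforce
    then show "\<exists>N. openin (topol E) N \<and> e \<in> N \<and> N \<subseteq> {e \<in> topspace (topol E). f e \<in> A}" using N by blast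
  qed
  show "f constant_on topspace (topol E)"
  proof (cases "topspace (topol E) = {}")
    case False
    then obtain e0 where e0: "e0 \<in> topspace (topol E)" by blast
    let ?A = "{e \<in> topspace (topol E). f e \<in> {f e0}}"
    have "topspace (topol E) - ?A = {e \<in> topspace (topol E). f e \<in> - {f e0}}" by blast
    then have "openin (topol E) (topspace (topol E) - ?A)" by (simp only: op)
    then have "closedin (topol E) ?A" unfolding closedin_def by blast
    then have "?A = topspace (topol E)"
      using conn op e0 unfolding connected_space_clopen_in by blast
    then show ?thesis unfolding constant_on_def by blast
  qed (simp add: constant_on_def)
qed

end

section \<open>Existence of small discs\<close>

lemma vec_dist_less:
  fixes u v :: "'a::euclidean_space ^ 'd"
  assumes "\<And>i. dist (u $ i) (v $ i) < \<epsilon> / CARD('d)"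
  shows "dist u v < \<epsilon>"
proof -
  have "dist u v \<le> (\<Sum>i\<in>UNIV. dist (u $ i) (v $ i))"
    unfolding dist_vec_def by (rule L2_set_le_sum) simp
  also have "\<dots> < (\<Sum>i\<in>(UNIV :: 'd set). \<epsilon> / CARD('d))"
    by (rule sum_strict_mono) (use assms in auto)
  finally show ?thesis by simp
qed

text \<open>The divisors in \<open>C\<^sub>d\<close> are represented by \<open>d\<close>-tuples of unit vectors, which form a compact metric
  space. The evenly covered sets induce an open cover of it, a Lebesgue number of which bounds the
  size of the discs; finitely many of these cover the unit vectors over \<open>C\<close>.\<close>

lemma charted_cover_exists:
  fixes C :: "(complex ^ 'n) set set" and E :: "'e holspace"
    and p :: "'e \<Rightarrow> ('d::finite \<Rightarrow> (complex ^ 'n) set) set"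
  assumes C: "smooth_projective_curve C"
    and cov: "unramified_covering E p (sym_power C)" and conn: "connected_space (topol E)"
  obtains I :: "(complex ^ 'n) set" and \<phi> \<Omega> where "charted_cover C E p I \<phi> \<Omega>"
proof -
  let ?X = "topol (sym_power C :: ('d \<Rightarrow> (complex ^ 'n) set) set holspace)"
  have closed: "proj_closed C" and dim: "proj_dim C = 1" and smooth: "proj_smooth C"
    using C by (auto simp: smooth_projective_curve_def proj_irreducible_def)
  have C_sub: "C \<subseteq> proj_space" by (rule proj_closed_subset[OF closed])
  have covering: "covering_map (topol E) p ?X" using cov by (simp add: unramified_covering_def)
  have "connectedin ?X (p ` topspace (topol E))"
    using covering conn by (intro connectedin_continuous_map_image) (auto simp: covering_map_def connectedin_topspace)
  then have "connected_space ?X"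
    using covering by (simp add: covering_map_def connectedin_topspace)
  then have C_conn: "connected_space (subtopology proj_topology C)" by (rule connected_curve[OF C_sub])
  define K where "K = {v \<in> affine_cone C. norm v = 1}"
  have K: "compact K" unfolding K_def by (rule compact_unit_cone[OF closed])
  define \<G> where "\<G> = {G :: (complex ^ 'n ^ 'd) set. open G \<and> (\<exists>U. evenly_covered (topol E) p ?X U \<and>
      (\<forall>v\<in>G. (\<forall>i. v $ i \<in> affine_cone C) \<longrightarrow> vec_orbit v \<in> U))}"
  have "{v :: complex ^ 'n ^ 'd. \<forall>i. v $ i \<in> K} \<subseteq> \<Union>\<G>"
  proof
    fix v :: "complex ^ 'n ^ 'd" assume "v \<in> {v. \<forall>i. v $ i \<in> K}"
    then have v: "v \<in> {v. \<forall>i. v $ i \<in> affine_cone C}" by (simp add: K_def)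
    then have "vec_orbit v \<in> topspace ?X"
      using continuous_map_vec_orbit by (auto simp: continuous_map_def Pi_iff)
    then obtain U where U: "vec_orbit v \<in> U" "evenly_covered (topol E) p ?X U"
      using covering_map_evenly_covered[OF covering] by blast
    then have "openin ?X U" by (simp add: evenly_covered_def)
    then have "openin (top_of_set {v. \<forall>i. v $ i \<in> affine_cone C})
        {v \<in> topspace (top_of_set {v :: complex ^ 'n ^ 'd. \<forall>i. v $ i \<in> affine_cone C}). vec_orbit v \<in> U}"
      by (rule openin_continuous_map_preimage[OF continuous_map_vec_orbit])
    then obtain G where G: "open G" "{v. \<forall>i. v $ i \<in> affine_cone C} \<inter> G =
        {v \<in> {v :: complex ^ 'n ^ 'd. \<forall>i. v $ i \<in> affine_cone C}. vec_orbit v \<in> U}"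
      unfolding openin_open by auto
    then have "v \<in> G" using v U by blast
    moreover have "G \<in> \<G>" unfolding \<G>_def using G U(2) by blast
    ultimately show "v \<in> \<Union>\<G>" by blast
  qed
  then obtain \<epsilon> where \<epsilon>: "\<epsilon> > 0" "\<And>v :: complex ^ 'n ^ 'd. v \<in> {v. \<forall>i. v $ i \<in> K} \<Longrightarrow> \<exists>G\<in>\<G>. ball v \<epsilon> \<subseteq> G"
    using Heine_Borel_lemma[OF compact_vec[OF K], of \<G>] unfolding \<G>_def by blast
  define \<delta> where "\<delta> = \<epsilon> / CARD('d)"
  have \<delta>: "\<delta> > 0" using \<epsilon> by (simp add: \<delta>_def)
  have "\<exists>\<phi> \<Omega>. chart C \<phi> \<Omega> \<and> x \<in> \<Omega> \<and> \<phi> ` ball 0 1 \<subseteq> ball x \<delta>" if "x \<in> K" for x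
  proof -
    have x: "x \<in> affine_cone C" using that by (simp add: K_def)
    then have "enat (vec.dim (cone_tangent C x)) = 1 + 1"
      using smooth dim by (simp add: proj_smooth_def affine_cone_def)
    also have "\<dots> = enat 2" by (simp add: numeral_eq_enat one_add_one)
    finally have d: "vec.dim (cone_tangent C x) = 2" by simp
    have "\<exists>v\<in>\<Omega> \<inter> affine_cone C. proj_point v \<noteq> proj_point x" if "open \<Omega>" "x \<in> \<Omega>" for \<Omega>
      by (rule connected_nonisolated[OF C_sub C_conn x two_points[OF dim] that])
    from chart_exists[OF closed x d this \<delta>]
    obtain \<phi> \<Omega> where "chart C \<phi> \<Omega>" "x \<in> \<Omega>" "\<phi> ` ball 0 1 \<subseteq> ball x \<delta>" .
    then show ?thesis by blast
  qed
  then obtain \<phi> \<Omega> where \<phi>: "\<And>x. x \<in> K \<Longrightarrow> chart C (\<phi> x) (\<Omega> x)" "\<And>x. x \<in> K \<Longrightarrow> x \<in> \<Omega> x"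
    "\<And>x. x \<in> K \<Longrightarrow> \<phi> x ` ball 0 1 \<subseteq> ball x \<delta>" by metis
  obtain I where I: "I \<subseteq> K" "finite I" "K \<subseteq> (\<Union>x\<in>I. \<Omega> x)"
    by (rule compactE_image[OF K, of K \<Omega>]) (use \<phi> in \<open>auto simp: chart_def\<close>)
  have "charted_cover C E p I \<phi> \<Omega>"
  proof (unfold_locales)
    show "C \<subseteq> proj_space" by (rule C_sub)
    show "connected_space (subtopology proj_topology C)" by (rule C_conn)
    show "unramified_covering E p (sym_power C)" by (rule cov)
    show "finite I" by (rule I)
    show "chart C (\<phi> i) (\<Omega> i)" if "i \<in> I" for i using that I \<phi> by blast
    show "\<exists>i\<in>I. L \<in> proj_point ` (\<Omega> i \<inter> affine_cone C)" if L: "L \<in> C" for L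
    proof -
      obtain v where v: "v \<in> affine_cone C" "L = proj_point v" using point_of_curve[OF C_sub L] .
      define u where "u = of_real (1 / norm v) *s v"
      have v0: "v \<noteq> 0" using v by (simp add: affine_cone_def)
      have "u = (1 / norm v) *\<^sub>R v"
        by (simp add: u_def vec_eq_iff scaleR_conv_of_real[where 'a = complex])
      then have "norm u = 1" using v0 by simp
      moreover have c0: "complex_of_real (1 / norm v) \<noteq> 0" using v0 by simp
      have u: "u \<in> affine_cone C" "L = proj_point u"
        using affine_cone_scale[OF v(1) c0] proj_point_scale[OF c0, of v] v(2) by (simp_all only: u_def)
      ultimately have "u \<in> K" by (simp add: K_def)
      then obtain i where "i \<in> I" "u \<in> \<Omega> i" using I by blast
      then show ?thesis using u by blast
    qed
    show "\<exists>U. evenly_covered (topol E) p ?X U \<and> (\<forall>v. (\<forall>k. v $ k \<in> \<phi> (\<iota> k) ` ball 0 1) \<longrightarrow> vec_orbit v \<in> U)"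
      if \<iota>: "range \<iota> \<subseteq> I" for \<iota> :: "'d \<Rightarrow> complex ^ 'n"
    proof -
      have \<iota>': "\<iota> k \<in> K" for k using \<iota> I by blast
      then obtain G where G: "G \<in> \<G>" "ball (\<chi> k. \<iota> k) \<epsilon> \<subseteq> G" using \<epsilon>(2)[of "\<chi> k. \<iota> k"] by auto
      obtain U where U: "evenly_covered (topol E) p ?X U"
        "\<And>v. v \<in> G \<Longrightarrow> (\<forall>i. v $ i \<in> affine_cone C) \<Longrightarrow> vec_orbit v \<in> U"
        using G(1) unfolding \<G>_def by blast
      have "vec_orbit v \<in> U" if v: "\<forall>k. v $ k \<in> \<phi> (\<iota> k) ` ball 0 1" for v
      proof (rule U(2))
        have near: "v $ k \<in> ball (\<iota> k) \<delta>" for k using v \<phi>(3)[OF \<iota>'] by blast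
        have "dist (\<chi> k. \<iota> k) v < \<epsilon>"
          by (rule vec_dist_less) (use near in \<open>simp add: \<delta>_def\<close>)
        then show "v \<in> G" using G(2) by auto
        show "\<forall>k. v $ k \<in> affine_cone C" using v \<phi>(1)[OF \<iota>'] unfolding chart_def by blast
      qed
      then show ?thesis using U(1) by blast
    qed
  qed
  then show ?thesis by (rule that)
qed

text \<open>Two constant loops are homotopic only if their base points are joined by a path.\<close>

lemma simply_connected_imp_connected:
  assumes "simply_connected_space T"
  shows "connected_space T"
proof -
  have "\<exists>g. pathin T g \<and> g 0 = x \<and> g 1 = y" if x: "x \<in> topspace T" and y: "y \<in> topspace T" for x y
  proof -
    have "homotopic_with (\<lambda>h. h 1 = h 0) (top_of_set {0..1}) T (\<lambda>_::real. x) (\<lambda>_. y)"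
      using assms x y unfolding simply_connected_space_def by (simp add: pathin_const)
    then obtain h :: "real \<times> real \<Rightarrow> 'a" where h: "continuous_map (prod_topology (top_of_set {0..1}) (top_of_set {0..1})) T h"
      "\<And>u. h (0, u) = x" "\<And>u. h (1, u) = y"
      unfolding homotopic_with_def by auto
    have "continuous_map (top_of_set {0..1::real}) (prod_topology (top_of_set {0..1}) (top_of_set {0..1::real})) (\<lambda>t. (t, 0))"
      by (intro continuous_map_pairedI continuous_map_id[unfolded id_def] continuous_map_const[THEN iffD2]) auto
    from continuous_map_compose[OF this h(1)]
    have "pathin T (\<lambda>t. h (t, 0))" by (simp add: pathin_def o_def)
    then show ?thesis using h by blast
  qed
  then have "path_connected_space T" unfolding path_connected_space_def by blast
  then show ?thesis by (rule path_connected_imp_connected_space)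
qed

theorem corollary3p9:
  fixes C :: "(complex ^ 'n) set set"
  assumes "smooth_projective_curve C"
    and "CARD('d::finite) \<ge> 2"
  shows "super_liouville TYPE('e) (sym_power C :: ('d \<Rightarrow> (complex ^ 'n) set) set holspace) \<and>
    (\<forall>(E :: 'e holspace) p.
      unramified_covering E p (sym_power C :: ('d \<Rightarrow> (complex ^ 'n) set) set holspace) \<and>
      connected_space (topol E) \<longrightarrow> liouville E)"
proof -
  have "liouville E"
    if cov: "unramified_covering E p (sym_power C :: ('d \<Rightarrow> (complex ^ 'n) set) set holspace)"
      and conn: "connected_space (topol E)" for E :: "'e holspace" and p
  proof -
    obtain I :: "(complex ^ 'n) set" and \<phi> \<Omega> where "charted_cover C E p I \<phi> \<Omega>"
      using charted_cover_exists[OF assms(1) cov conn] .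
    then show ?thesis by (rule charted_cover.bounded_hol_constant) (use assms(2) conn in auto)
  qed
  then show ?thesis
    unfolding super_liouville_def universal_covering_def using simply_connected_imp_connected by blast
qed

end
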